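(* Let $G$ be a finite connected graph with $N_s$ vertices, let $U,J>0$, and let $1\le M\le N_s-1$. Let $$H_{\mathrm{exact}}=U\sum_{\bm R}(1-P_{\bm R})+J\sum_{\langle\bm R\bm R'\rangle}h_{\bm R\bm R'}.$$ Let $\Delta_M^{(0,4)}$ be the first excitation energy (second-lowest eigenvalue minus lowest eigenvalue) of $H_{\mathrm{exact}}$ restricted to the states with $N_e=4M$ in which every cell is either empty or fully occupied, and let $\Delta_M$ be the first excitation energy of $H_{\mathrm{exact}}$ in the full fixed-charge sector $N_e=4M$. Let $\lambda_2(L_G)$ be the smallest positive eigenvalue of the graph Laplacian $L_G$. Then $$\Delta_M^{(0,4)}=\frac J2\lambda_2(L_G),\qquad \Delta_M=\min\Big\{\frac J2\lambda_2(L_G),\,2U\Big\}.$$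
   Context: The vertices $\bm R$ of $G$ label cells; each cell carries four fermionic modes with creation operators $c_{\bm R,m}^\dagger$, $m=1,\dots,4$ (canonical anticommutation relations), and number operators $\hat n_{\bm R,m}=c_{\bm R,m}^\dagger c_{\bm R,m}$; $N_e=\sum_{\bm R,m}\hat n_{\bm R,m}$. Define $q_{\bm R}^\dagger=c_{\bm R,1}^\dagger c_{\bm R,2}^\dagger c_{\bm R,3}^\dagger c_{\bm R,4}^\dagger$, $q_{\bm R}=(q_{\bm R}^\dagger)^\dagger$, $P_{\bm R}^{(0)}=\prod_m(1-\hat n_{\bm R,m})$, $P_{\bm R}^{(4)}=\prod_m\hat n_{\bm R,m}$, $P_{\bm R}=P_{\bm R}^{(0)}+P_{\bm R}^{(4)}$. For each edge $\langle\bm R\bm R'\rangle$ of $G$, $$h_{\bm R\bm R'}=\tfrac12\left[P_{\bm R}^{(4)}P_{\bm R'}^{(0)}+P_{\bm R}^{(0)}P_{\bm R'}^{(4)}-q_{\bm R}^\dagger q_{\bm R'}-q_{\bm R'}^\dagger q_{\bm R}\right].$$ $L_G=D_G-A_G$ is the Laplacian of $G$, with $A_G$ the adjacency matrix and $D_G$ the diagonal degree matrix. *)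

theory Defs
  imports "HOL-Analysis.Analysis" "HOL-Library.Multiset"
begin

definition simple_graph :: "('v \<Rightarrow> 'v \<Rightarrow> bool) \<Rightarrow> bool" where
  "simple_graph adj \<longleftrightarrow> symp adj \<and> irreflp adj"

definition connected_graph :: "('v \<Rightarrow> 'v \<Rightarrow> bool) \<Rightarrow> bool" where
  "connected_graph adj \<longleftrightarrow> (\<forall>u v. adj\<^sup>*\<^sup>* u v)"

definition adjacency_matrix :: "('v::finite \<Rightarrow> 'v \<Rightarrow> bool) \<Rightarrow> real^'v^'v" where
  "adjacency_matrix adj = (\<chi> u v. if adj u v then 1 else 0)"

definition degree_matrix :: "('v::finite \<Rightarrow> 'v \<Rightarrow> bool) \<Rightarrow> real^'v^'v" where
  "degree_matrix adj = (\<chi> u v. if u = v then real (card {w. adj u w}) else 0)"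

definition laplacian :: "('v::finite \<Rightarrow> 'v \<Rightarrow> bool) \<Rightarrow> real^'v^'v" where
  "laplacian adj = degree_matrix adj - adjacency_matrix adj"

text \<open>Eigenvectors of \<open>A\<close> inside a subspace \<open>W\<close>, together with 0. When \<open>W\<close> is invariant
  under \<open>A\<close>, this is the eigenspace of the restriction of \<open>A\<close> to \<open>W\<close>.\<close>

definition eigenspace_on :: "'a::field^'n^'n \<Rightarrow> ('a^'n) set \<Rightarrow> 'a \<Rightarrow> ('a^'n) set" where
  "eigenspace_on A W e = {x \<in> W. A *v x = e *s x}"

definition eigenvalue_on :: "'a::field^'n^'n \<Rightarrow> ('a^'n) set \<Rightarrow> 'a \<Rightarrow> bool" where
  "eigenvalue_on A W e \<longleftrightarrow> (\<exists>x \<in> eigenspace_on A W e. x \<noteq> 0)"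

definition lambda2 :: "real^'n^'n \<Rightarrow> real" where
  "lambda2 L = Min {e. 0 < e \<and> eigenvalue_on L UNIV e}"

text \<open>The energy levels of a Hermitian matrix on an invariant subspace, in increasing order and
  repeated according to multiplicity (\<open>vec.dim\<close> is the dimension over the complex numbers). Since
  the matrix is Hermitian, all its eigenvalues are real, and geometric and algebraic
  multiplicities agree.\<close>

definition energy_levels :: "complex^'n^'n \<Rightarrow> (complex^'n) set \<Rightarrow> real list" where
  "energy_levels A W = sorted_list_of_multiset
     (\<Sum>e \<in> {e. eigenvalue_on A W (complex_of_real e)}.
        replicate_mset (vec.dim (eigenspace_on A W (complex_of_real e))) e)"

definition excitation_gap :: "complex^'n^'n \<Rightarrow> (complex^'n) set \<Rightarrow> real" where
  "excitation_gap A W = energy_levels A W ! 1 - energy_levels A W ! 0"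

text \<open>A mode is a pair of a cell and a flavour. The flavours \<open>1, 2, 3, 4\<close> are the four elements of
  the numeral type \<open>4\<close> (where \<open>4 = 0\<close>). The Fock space has the occupation number basis, indexed
  by the set of occupied modes. Operators are matrices in this basis, so that operator composition
  is \<open>**\<close> and the identity is \<open>mat 1\<close>.\<close>

type_synonym 'v mode = "'v \<times> 4"
type_synonym 'v fock = "complex^('v mode set)"
type_synonym 'v fock_op = "complex^('v mode set)^('v mode set)"

definition dagger :: "complex^'n^'m \<Rightarrow> complex^'m^'n" where
  "dagger A = (\<chi> i j. cnj (A $ j $ i))"

text \<open>Jordan-Wigner sign with respect to an arbitrary fixed enumeration \<open>to_nat\<close> of the modes.
  The canonical anticommutation relations are proved below.\<close>

definition jw_sign :: "'v::finite mode \<Rightarrow> 'v mode set \<Rightarrow> complex" where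
  "jw_sign a S = (-1) ^ card {b \<in> S. to_nat b < to_nat a}"

definition cre :: "'v::finite mode \<Rightarrow> 'v fock_op" where
  "cre a = (\<chi> T S. if a \<notin> S \<and> T = insert a S then jw_sign a S else 0)"

definition ann :: "'v::finite mode \<Rightarrow> 'v fock_op" where
  "ann a = dagger (cre a)"

lemma jw_sign_insert:
  "b \<notin> S \<Longrightarrow> jw_sign a (insert b S) = (if to_nat b < to_nat a then - jw_sign a S else jw_sign a S)"
proof -
  assume b: "b \<notin> S"
  have "{x \<in> insert b S. to_nat x < to_nat a} =
    (if to_nat b < to_nat a then insert b {x \<in> S. to_nat x < to_nat a} else {x \<in> S. to_nat x < to_nat a})"
    by auto
  then show ?thesis using b by (simp add: jw_sign_def)
qed

lemma jw_sign_sq: "jw_sign a S * jw_sign a S = 1"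
  by (simp add: jw_sign_def flip: power_mult_distrib)

lemma cre_nth: "cre a $ T $ S = (if a \<notin> S \<and> T = insert a S then jw_sign a S else 0)"
  by (simp add: cre_def)

lemma ann_nth: "ann a $ T $ S = (if a \<notin> T \<and> S = insert a T then jw_sign a T else 0)"
  by (simp add: ann_def dagger_def cre_def jw_sign_def)

lemma cre_cre_nth:
  "(cre a ** cre b) $ T $ S =
    (if b \<notin> S \<and> a \<notin> insert b S \<and> T = insert a (insert b S)
     then jw_sign a (insert b S) * jw_sign b S else 0)"
proof -
  have "(cre a ** cre b) $ T $ S = (\<Sum>X\<in>UNIV. if X = insert b S then cre a $ T $ X * cre b $ X $ S else 0)"
    unfolding matrix_matrix_mult_def vec_lambda_beta
    by (rule sum.cong[OF refl]) (auto simp: cre_nth)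
  also have "\<dots> = cre a $ T $ insert b S * cre b $ insert b S $ S" by simp
  finally show ?thesis by (auto simp: cre_nth)
qed

lemma cre_ann_nth:
  "(cre a ** ann b) $ T $ S =
    (if b \<in> S \<and> a \<notin> S - {b} \<and> T = insert a (S - {b})
     then jw_sign a (S - {b}) * jw_sign b (S - {b}) else 0)"
proof -
  have "(cre a ** ann b) $ T $ S = (\<Sum>X\<in>UNIV. if X = S - {b} then cre a $ T $ X * ann b $ X $ S else 0)"
    unfolding matrix_matrix_mult_def vec_lambda_beta
    by (rule sum.cong[OF refl]) (auto simp: ann_nth)
  also have "\<dots> = cre a $ T $ (S - {b}) * ann b $ (S - {b}) $ S" by simp
  finally show ?thesis by (auto simp: cre_nth ann_nth)
qed

lemma ann_cre_nth:
  "(ann b ** cre a) $ T $ S =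
    (if a \<notin> S \<and> b \<in> insert a S \<and> T = insert a S - {b}
     then jw_sign b (insert a S - {b}) * jw_sign a S else 0)"
proof -
  have "(ann b ** cre a) $ T $ S = (\<Sum>X\<in>UNIV. if X = insert a S then ann b $ T $ X * cre a $ X $ S else 0)"
    unfolding matrix_matrix_mult_def vec_lambda_beta
    by (rule sum.cong[OF refl]) (auto simp: cre_nth)
  also have "\<dots> = ann b $ T $ (insert a S) * cre a $ (insert a S) $ S" by simp
  finally show ?thesis by (auto simp: cre_nth ann_nth)
qed

lemma CAR_cre_cre: "cre a ** cre b + cre b ** cre a = 0"
proof (cases "a = b")
  case True
  then show ?thesis by (simp add: vec_eq_iff cre_cre_nth)
next
  case False
  then have "to_nat a < to_nat b \<or> to_nat b < to_nat a"
    by (metis nat_neq_iff to_nat_split)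
  then show ?thesis
    using False by (auto simp: vec_eq_iff cre_cre_nth jw_sign_insert insert_commute)
qed

lemma CAR_ann_cre: "ann a ** cre b + cre b ** ann a = (if a = b then mat 1 else 0)"
proof (cases "a = b")
  case True
  then show ?thesis
    by (auto simp: vec_eq_iff ann_cre_nth cre_ann_nth mat_def jw_sign_sq insert_absorb)
next
  case False
  then have ord: "to_nat a < to_nat b \<or> to_nat b < to_nat a"
    by (metis nat_neq_iff to_nat_split)
  have "(ann a ** cre b) $ T $ S + (cre b ** ann a) $ T $ S = 0" for T S
  proof (cases "a \<in> S \<and> b \<notin> S")
    case True
    define X where "X = S - {a}"
    have X: "S = insert a X" "a \<notin> X" "b \<notin> X" using True by (auto simp: X_def)
    have "insert b (insert a X) - {a} = insert b X" using X False by auto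
    then show ?thesis
      using X False ord by (auto simp: ann_cre_nth cre_ann_nth jw_sign_insert)
  next
    case F: False
    then show ?thesis using False by (auto simp: ann_cre_nth cre_ann_nth)
  qed
  then show ?thesis using False by (simp add: vec_eq_iff)
qed

definition num_op :: "'v::finite \<Rightarrow> 4 \<Rightarrow> 'v fock_op" where
  "num_op R m = cre (R, m) ** ann (R, m)"

definition total_num :: "'v::finite fock_op" where
  "total_num = (\<Sum>R\<in>UNIV. \<Sum>m\<in>UNIV. num_op R m)"

definition qdag :: "'v::finite \<Rightarrow> 'v fock_op" where
  "qdag R = cre (R, 1) ** cre (R, 2) ** cre (R, 3) ** cre (R, 4)"

definition qop :: "'v::finite \<Rightarrow> 'v fock_op" where
  "qop R = dagger (qdag R)"

definition P0 :: "'v::finite \<Rightarrow> 'v fock_op" where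
  "P0 R = (mat 1 - num_op R 1) ** (mat 1 - num_op R 2) ** (mat 1 - num_op R 3) ** (mat 1 - num_op R 4)"

definition P4 :: "'v::finite \<Rightarrow> 'v fock_op" where
  "P4 R = num_op R 1 ** num_op R 2 ** num_op R 3 ** num_op R 4"

definition Pcell :: "'v::finite \<Rightarrow> 'v fock_op" where
  "Pcell R = P0 R + P4 R"

definition diag_op :: "('v::finite mode set \<Rightarrow> complex) \<Rightarrow> 'v fock_op" where
  "diag_op f = (\<chi> T S. if T = S then f S else 0)"

lemma diag_op_mult: "diag_op f ** diag_op g = diag_op (\<lambda>S. f S * g S)"
proof -
  have "(\<Sum>X\<in>UNIV. diag_op f $ T $ X * diag_op g $ X $ S) = diag_op (\<lambda>S. f S * g S) $ T $ S" for T S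
  proof -
    have "(\<Sum>X\<in>UNIV. diag_op f $ T $ X * diag_op g $ X $ S) =
        (\<Sum>X\<in>UNIV. if X = S then diag_op f $ T $ S * diag_op g $ S $ S else 0)"
      by (rule sum.cong[OF refl]) (simp add: diag_op_def)
    then show ?thesis by (simp add: diag_op_def)
  qed
  then show ?thesis by (simp add: vec_eq_iff matrix_matrix_mult_def)
qed

lemma num_op_diag: "num_op R m = diag_op (\<lambda>S. of_bool ((R, m) \<in> S))"
  by (auto simp: num_op_def vec_eq_iff cre_ann_nth diag_op_def jw_sign_sq insert_absorb)

lemma P4_diag: "P4 (R :: 'v::finite) = diag_op (\<lambda>S. of_bool (\<forall>m. (R, m) \<in> S))"
proof -
  have "(\<forall>m. (R, m) \<in> S) \<longleftrightarrow> (R, 1) \<in> S \<and> (R, 2) \<in> S \<and> (R, 3) \<in> S \<and> (R, 4) \<in> S"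
    for S :: "'v mode set"
    by (simp add: forall_4)
  then show ?thesis
    by (simp add: P4_def num_op_diag diag_op_mult of_bool_conj mult.assoc)
qed

lemma P0_diag: "P0 (R :: 'v::finite) = diag_op (\<lambda>S. of_bool (\<forall>m. (R, m) \<notin> S))"
proof -
  have "(\<forall>m. (R, m) \<notin> S) \<longleftrightarrow> (R, 1) \<notin> S \<and> (R, 2) \<notin> S \<and> (R, 3) \<notin> S \<and> (R, 4) \<notin> S"
    for S :: "'v mode set"
    by (simp add: forall_4)
  moreover have "mat 1 - num_op R m = diag_op (\<lambda>S. of_bool ((R, m) \<notin> S))" for m
    by (simp add: num_op_diag diag_op_def vec_eq_iff mat_def)
  ultimately show ?thesis
    by (simp add: P0_def diag_op_mult of_bool_conj mult.assoc)
qed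

definition h_edge :: "'v::finite \<Rightarrow> 'v \<Rightarrow> 'v fock_op" where
  "h_edge R R' = (1/2) *\<^sub>R
     (P4 R ** P0 R' + P0 R ** P4 R' - qdag R ** qop R' - qdag R' ** qop R)"

lemma h_edge_commute: "h_edge R R' = h_edge R' R"
  by (simp add: h_edge_def P0_diag P4_diag diag_op_mult algebra_simps)

text \<open>\<open>h_edge\<close> is symmetric in its two arguments, and every edge occurs as the two
  ordered pairs \<open>(R, R')\<close> and \<open>(R', R)\<close>; the factor \<open>1/2\<close> in front of the double
  sum makes each edge count exactly once.\<close>

definition H_exact :: "real \<Rightarrow> real \<Rightarrow> ('v::finite \<Rightarrow> 'v \<Rightarrow> bool) \<Rightarrow> 'v fock_op" where
  "H_exact U J adj =
     U *\<^sub>R (\<Sum>R\<in>UNIV. mat 1 - Pcell R) +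
     J *\<^sub>R ((1/2) *\<^sub>R (\<Sum>R\<in>UNIV. \<Sum>R'\<in>{R'. adj R R'}. h_edge R R'))"

definition charge_sector :: "nat \<Rightarrow> 'v::finite fock set" where
  "charge_sector N = {x. total_num *v x = of_nat N *s x}"

definition sector04 :: "nat \<Rightarrow> 'v::finite fock set" where
  "sector04 N = {x \<in> charge_sector N. \<forall>R. Pcell R *v x = x}"

end

theory Submission
  imports Defs
begin

text \<open>On the states in which every cell is empty or full, a diagonal change of signs turns
  \<open>H_exact\<close> into \<open>J / 2\<close> times the generator of the symmetric exclusion process with \<open>M\<close>
  particles. Its spectral gap equals \<open>\<lambda>\<^sub>2\<close> of the Laplacian by the theorem of Caputo, Liggett and
  Richthammer (Aldous' conjecture), which is proved here for exclusion: functions linear in the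
  occupation numbers reproduce the random walk; on their orthogonal complement one removes a vertex,
  redistributes its rates as in a star-mesh transformation, and inducts, the loss being
  controlled by the octopus inequality.

  The octopus operator \<open>Q\<close> with leg weights \<open>c\<close> satisfies \<open>Q\<^sup>2 \<le> ((\<Sum>c)\<^sup>2 + \<Sum>c\<^sup>2) Q\<close>, which
  forces \<open>Q \<ge> 0\<close>. The difference of the two sides is a combination, with coefficients
  \<open>c\<^sub>x c\<^sub>y c\<^sub>u c\<^sub>w \<ge> 0\<close>, of operators that only move particles between the centre and four legs,
  and for occupation numbers these are explicit sums of squares.

  States with broken cells decouple. Charge divisible by four excludes a single broken cell, and the
  hopping term is nonnegative, so their energy is at least \<open>2 U\<close>; two broken cells with one and
  three fermions next to \<open>M - 1\<close> full cells attain it.\<close>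

section \<open>The octopus inequality\<close>

text \<open>Cutting a function of sum zero into its halves with the removed vertex \<open>z\<close>
  empty and occupied leaves two functions with opposite, in general nonzero sums, to which an
  induction hypothesis on mean zero functions says nothing. Orthogonality to the occupation number
  of \<open>z\<close> makes both sums vanish; this is why the linear functions are split off anew at
  every stage. The halves then evolve with the star-mesh rates, and the walk gap does not drop,
  because the walk form of the reduced graph is the old form at the harmonic extension. With
  \<open>K\<close> the constant in \<open>Q\<^sup>2 \<le> K Q\<close>, pairing with \<open>f\<close>
  gives \<open>0 \<le> K * \<langle>f, Q f\<rangle>\<close>, so positivity of \<open>Q\<close> costs
  no more than this operator bound. The change of signs exists even on graphs with cycles because a
  quartet is an even product of fermion operators: quartets on different cells commute, so no closed
  loop of hops accumulates a sign.\<close>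

definition swap_set :: "'v \<Rightarrow> 'v \<Rightarrow> 'v set \<Rightarrow> 'v set" where
  "swap_set x y A = Transposition.transpose x y ` A"

lemma swap_set_iff: "p \<in> swap_set x y A \<longleftrightarrow> (if p = x then y \<in> A else if p = y then x \<in> A else p \<in> A)"
  unfolding swap_set_def by (auto simp: image_iff Transposition.transpose_def split: if_splits)

lemma swap_set_self [simp]: "swap_set x x A = A"
  by (auto simp: swap_set_iff split: if_splits)

lemma swap_set_commute: "swap_set x y = swap_set y x"
  by (auto simp: swap_set_iff fun_eq_iff set_eq_iff)

lemma swap_set_invol [simp]: "swap_set x y (swap_set x y A) = A"
  by (auto simp: swap_set_iff split: if_splits)

lemma bij_swap_set: "bij (swap_set x y)"
  by (rule bij_betw_byWitness[where f' = "swap_set x y"]) auto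

lemma card_swap_set [simp]: "card (swap_set x y A) = card A"
  unfolding swap_set_def by (simp add: card_image)

lemma sum_swap_set: "(\<Sum>A\<in>UNIV. h (swap_set x y A)) = (\<Sum>A\<in>UNIV. h A)"
  for h :: "'v set \<Rightarrow> real"
  by (rule sum.reindex_bij_betw[OF bij_swap_set])

definition put :: "'v \<Rightarrow> bool \<Rightarrow> 'v set \<Rightarrow> 'v set" where
  "put p b A = (if b then insert p A else A - {p})"

lemma put_iff: "q \<in> put p b A \<longleftrightarrow> (if q = p then b else q \<in> A)"
  by (auto simp: put_def)

text \<open>Toggling the occupation of \<open>p\<close> is an involution on sets, so every set
  arises twice. Applied once per site, this exposes the few sites on which a local operator acts and
  leaves the rest as a frozen background.\<close>

lemma sum_put: "(\<Sum>A\<in>UNIV. h A) = (\<Sum>A\<in>UNIV. \<Sum>b\<in>UNIV. h (put p b A)) / 2"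
  for h :: "'v::finite set \<Rightarrow> real"
proof -
  define flip where "flip A = (if p \<in> A then A - {p} else insert p A)" for A
  have "bij flip"
    by (rule bij_betw_byWitness[where f' = flip]) (auto simp: flip_def)
  then have "(\<Sum>A\<in>UNIV. h (flip A)) = (\<Sum>A\<in>UNIV. h A)"
    by (rule sum.reindex_bij_betw)
  moreover have "(\<Sum>b\<in>UNIV. h (put p b A)) = h A + h (flip A)" for A
    by (auto simp: UNIV_bool put_def flip_def insert_absorb)
  ultimately show ?thesis by (simp add: sum.distrib)
qed

text \<open>\<open>(\<Sum>x y. c x * c y * face z f x y) / 2\<close> is the octopus operator with centre \<open>z\<close>; for
  \<open>x = y\<close> the definition yields \<open>2 * (f - f \<circ> swap_set z x)\<close>.\<close>

definition face :: "'v \<Rightarrow> ('v set \<Rightarrow> real) \<Rightarrow> 'v \<Rightarrow> 'v \<Rightarrow> 'v set \<Rightarrow> real" where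
  "face z f x y A = f A - f (swap_set z x A) - f (swap_set z y A) + f (swap_set x y A)"

definition ip :: "('v::finite set \<Rightarrow> real) \<Rightarrow> ('v set \<Rightarrow> real) \<Rightarrow> real" where
  "ip f g = (\<Sum>A\<in>UNIV. f A * g A)"

text \<open>The summand of \<open>4 (((\<Sum>c)\<^sup>2 + \<Sum>c\<^sup>2) Q - Q\<^sup>2)\<close> at \<open>c x * c y * c u * c w\<close>; it becomes nonnegative
  after averaging over the three ways to pair up the four legs.\<close>

definition pair_form :: "'v::finite \<Rightarrow> ('v set \<Rightarrow> real) \<Rightarrow> 'v \<Rightarrow> 'v \<Rightarrow> 'v \<Rightarrow> 'v \<Rightarrow> real" where
  "pair_form z f x y u w =
     (1 + of_bool (u = w)) * ip f (face z f x y) + (1 + of_bool (x = y)) * ip f (face z f u w)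
     - ip (face z f x y) (face z f u w)"

text \<open>The argument positions of \<open>g\<close> are the occupations of the centre and the four legs, and
  \<open>Gij\<close> is \<open>face\<close> for the legs \<open>i\<close> and \<open>j\<close>. Only the sectors with two and three particles
  contribute; they are exchanged by \<open>t \<mapsto> \<not> t\<close>.\<close>

lemma five_site_identity:
  fixes g :: "bool \<Rightarrow> bool \<Rightarrow> bool \<Rightarrow> bool \<Rightarrow> bool \<Rightarrow> real"
  defines "G12 \<equiv> (\<lambda>a b c d e. g a b c d e - g b a c d e - g c b a d e + g a c b d e)"
  and "G34 \<equiv> (\<lambda>a b c d e. g a b c d e - g d b c a e - g e b c d a + g a b c e d)"
  and "G13 \<equiv> (\<lambda>a b c d e. g a b c d e - g b a c d e - g d b c a e + g a d c b e)"
  and "G24 \<equiv> (\<lambda>a b c d e. g a b c d e - g c b a d e - g e b c d a + g a b e d c)"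
  and "G14 \<equiv> (\<lambda>a b c d e. g a b c d e - g b a c d e - g e b c d a + g a e c d b)"
  and "G23 \<equiv> (\<lambda>a b c d e. g a b c d e - g c b a d e - g d b c a e + g a b d c e)"
  shows "(\<Sum>a\<in>UNIV. \<Sum>b\<in>UNIV. \<Sum>c\<in>UNIV. \<Sum>d\<in>UNIV. \<Sum>e\<in>UNIV.
     g a b c d e * (G12 a b c d e + G34 a b c d e + G13 a b c d e + G24 a b c d e + G14 a b c d e + G23 a b c d e)
      - G12 a b c d e * G34 a b c d e - G13 a b c d e * G24 a b c d e - G14 a b c d e * G23 a b c d e)
    = 2 * (\<Sum>t\<in>UNIV.
       (g t t (\<not>t) (\<not>t) (\<not>t) + g t (\<not>t) t (\<not>t) (\<not>t) - g t (\<not>t) (\<not>t) t (\<not>t) - g t (\<not>t) (\<not>t) (\<not>t) t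
         - g (\<not>t) t t (\<not>t) (\<not>t) + g (\<not>t) (\<not>t) (\<not>t) t t)\<^sup>2
     + (g t t (\<not>t) (\<not>t) (\<not>t) - g t (\<not>t) t (\<not>t) (\<not>t) + g t (\<not>t) (\<not>t) t (\<not>t) - g t (\<not>t) (\<not>t) (\<not>t) t
         - g (\<not>t) t (\<not>t) t (\<not>t) + g (\<not>t) (\<not>t) t (\<not>t) t)\<^sup>2
     + (g t t (\<not>t) (\<not>t) (\<not>t) - g t (\<not>t) t (\<not>t) (\<not>t) - g t (\<not>t) (\<not>t) t (\<not>t) + g t (\<not>t) (\<not>t) (\<not>t) t
         - g (\<not>t) t (\<not>t) (\<not>t) t + g (\<not>t) (\<not>t) t t (\<not>t))\<^sup>2)"
  unfolding UNIV_bool G12_def G34_def G13_def G24_def G14_def G23_def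
  by (simp, simp add: power2_eq_square algebra_simps)

text \<open>Leg 1 occurs twice here, so two of the three pairings coincide and carry the factor 2.
  Only the half-filled sector contributes, and only through the sum of the values at a configuration
  and at its complement.\<close>

lemma four_site_identity:
  fixes g :: "bool \<Rightarrow> bool \<Rightarrow> bool \<Rightarrow> bool \<Rightarrow> real"
  defines "G11 \<equiv> (\<lambda>a b c d. g a b c d - g b a c d - g b a c d + g a b c d)"
  and "G23 \<equiv> (\<lambda>a b c d. g a b c d - g c b a d - g d b c a + g a b d c)"
  and "G12 \<equiv> (\<lambda>a b c d. g a b c d - g b a c d - g c b a d + g a c b d)"
  and "G13 \<equiv> (\<lambda>a b c d. g a b c d - g b a c d - g d b c a + g a d c b)"
  shows "(\<Sum>a\<in>UNIV. \<Sum>b\<in>UNIV. \<Sum>c\<in>UNIV. \<Sum>d\<in>UNIV.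
     g a b c d * (G11 a b c d + 2 * G23 a b c d + 2 * G12 a b c d + 2 * G13 a b c d)
      - G11 a b c d * G23 a b c d - 2 * (G12 a b c d * G13 a b c d))
    = 2 * ((g True True False False + g False False True True - g True False True False - g False True False True)\<^sup>2
         + (g True True False False + g False False True True - g True False False True - g False True True False)\<^sup>2
         + (g True False True False + g False True False True - g True False False True - g False True True False)\<^sup>2)"
  unfolding UNIV_bool G11_def G12_def G13_def G23_def
  by (simp, simp add: power2_eq_square algebra_simps)

section \<open>Nonnegativity of the symmetrised pair forms\<close>

lemma UNIV_sum_bool: "(\<Sum>b\<in>UNIV. h b) = h False + (h True :: real)"
  by (simp add: UNIV_bool)

lemma face_commute: "face z f x y = face z f y x"
  by (simp add: face_def fun_eq_iff swap_set_commute)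

lemma pair_form_commute: "pair_form z f x y u w = pair_form z f u w x y"
  by (simp add: pair_form_def ip_def algebra_simps)

lemma pair_form_commute1: "pair_form z f x y u w = pair_form z f y x u w"
  by (simp add: pair_form_def face_commute[of z f x y] eq_commute[of x y])

text \<open>Reindexing by the swap turns each sum of squares into twice the norm minus twice a
  correlation. The octopus form thereby becomes a comparison of the edges at the centre with the
  edges between legs.\<close>

lemma ip_face: "ip f (face z f x y) =
  ((\<Sum>A\<in>UNIV. (f A - f (swap_set z x A))\<^sup>2) + (\<Sum>A\<in>UNIV. (f A - f (swap_set z y A))\<^sup>2)
   - (\<Sum>A\<in>UNIV. (f A - f (swap_set x y A))\<^sup>2)) / 2"
proof -
  have d: "(\<Sum>A\<in>UNIV. (f A - f (swap_set p q A))\<^sup>2)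
    = 2 * (\<Sum>A\<in>UNIV. f A * f A) - 2 * (\<Sum>A\<in>UNIV. f A * f (swap_set p q A))" for p q
  proof -
    have "(\<Sum>A\<in>UNIV. (f A - f (swap_set p q A))\<^sup>2)
      = (\<Sum>A\<in>UNIV. f A * f A + f (swap_set p q A) * f (swap_set p q A) - 2 * (f A * f (swap_set p q A)))"
      by (rule sum.cong) (simp_all add: power2_eq_square algebra_simps)
    then show ?thesis
      using sum_swap_set[of "\<lambda>A. f A * f A" p q]
      by (simp add: sum.distrib sum_subtractf sum_distrib_left)
  qed
  show ?thesis
    unfolding d by (simp add: ip_def face_def algebra_simps sum.distrib sum_subtractf)
qed

text \<open>With the other sites frozen at \<open>A\<close>, \<open>cfg A\<close> makes
  \<open>f\<close> a function of five bits, and every swap permutes these arguments. The local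
  identity then applies to each background separately.\<close>

lemma pair_form_nonneg_distinct:
  assumes d: "distinct [z, x, y, u, w]"
  shows "0 \<le> pair_form z f x y u w + pair_form z f x u y w + pair_form z f x w y u"
proof -
  define h where "h A = f A * (face z f x y A + face z f u w A + face z f x u A + face z f y w A
      + face z f x w A + face z f y u A)
     - face z f x y A * face z f u w A - face z f x u A * face z f y w A
     - face z f x w A * face z f y u A" for A
  define cfg where "cfg A a b c d e = put z a (put x b (put y c (put u d (put w e A))))" for A a b c d e
  have sw: "swap_set z x (cfg A a b c d e) = cfg A b a c d e" "swap_set z y (cfg A a b c d e) = cfg A c b a d e"
    "swap_set z u (cfg A a b c d e) = cfg A d b c a e" "swap_set z w (cfg A a b c d e) = cfg A e b c d a"
    "swap_set x y (cfg A a b c d e) = cfg A a c b d e" "swap_set x u (cfg A a b c d e) = cfg A a d c b e"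
    "swap_set x w (cfg A a b c d e) = cfg A a e c d b" "swap_set y u (cfg A a b c d e) = cfg A a b d c e"
    "swap_set y w (cfg A a b c d e) = cfg A a b e d c" "swap_set u w (cfg A a b c d e) = cfg A a b c e d"
    for A a b c d e
    using d by (auto simp: set_eq_iff swap_set_iff cfg_def put_iff)
  have "pair_form z f x y u w + pair_form z f x u y w + pair_form z f x w y u = (\<Sum>A\<in>UNIV. h A)"
    using d by (simp add: pair_form_def ip_def h_def algebra_simps sum.distrib sum_subtractf)
  also have "\<dots> = (\<Sum>A\<in>UNIV. \<Sum>a\<in>UNIV. \<Sum>b\<in>UNIV. \<Sum>c\<in>UNIV. \<Sum>d\<in>UNIV. \<Sum>e\<in>UNIV. h (cfg A a b c d e)) / 32"
    unfolding cfg_def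
    by (subst sum_put[where p = z], subst sum_put[where p = x], subst sum_put[where p = y],
      subst sum_put[where p = u], subst sum_put[where p = w]) (simp add: UNIV_sum_bool add_ac)
  also have "\<dots> \<ge> 0"
    unfolding h_def face_def sw swap_set_self five_site_identity[where g = "\<lambda>a b c d e. f (cfg A a b c d e)" for A]
    by (intro divide_nonneg_pos sum_nonneg mult_nonneg_nonneg add_nonneg_nonneg) auto
  finally show ?thesis .
qed

lemma pair_form_nonneg_diagonal:
  assumes d: "distinct [z, x, u, w]"
  shows "0 \<le> pair_form z f x x u w + 2 * pair_form z f x u x w"
proof -
  define h where "h A = f A * (face z f x x A + 2 * face z f u w A + 2 * face z f x u A + 2 * face z f x w A)
     - face z f x x A * face z f u w A - 2 * (face z f x u A * face z f x w A)" for A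
  define cfg where "cfg A a b c d = put z a (put x b (put u c (put w d A)))" for A a b c d
  have sw: "swap_set z x (cfg A a b c d) = cfg A b a c d" "swap_set z u (cfg A a b c d) = cfg A c b a d"
    "swap_set z w (cfg A a b c d) = cfg A d b c a"
    "swap_set x u (cfg A a b c d) = cfg A a c b d"
    "swap_set x w (cfg A a b c d) = cfg A a d c b"
    "swap_set u w (cfg A a b c d) = cfg A a b d c"
    for A a b c d
    using d by (auto simp: set_eq_iff swap_set_iff cfg_def put_iff)
  have "pair_form z f x x u w + 2 * pair_form z f x u x w = (\<Sum>A\<in>UNIV. h A)"
    using d by (simp add: pair_form_def ip_def h_def algebra_simps sum.distrib sum_subtractf sum_distrib_left)
  also have "\<dots> = (\<Sum>A\<in>UNIV. \<Sum>a\<in>UNIV. \<Sum>b\<in>UNIV. \<Sum>c\<in>UNIV. \<Sum>d\<in>UNIV. h (cfg A a b c d)) / 16"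
    unfolding cfg_def
    by (subst sum_put[where p = z], subst sum_put[where p = x], subst sum_put[where p = u],
      subst sum_put[where p = w]) (simp add: UNIV_sum_bool add_ac)
  also have "\<dots> \<ge> 0"
    unfolding h_def face_def sw swap_set_self four_site_identity[where g = "\<lambda>a b c d. f (cfg A a b c d)" for A]
    by (intro divide_nonneg_pos sum_nonneg mult_nonneg_nonneg add_nonneg_nonneg) auto
  finally show ?thesis .
qed

text \<open>With at most two legs the bound on \<open>Q\<^sup>2\<close> is an equality, so these
  combinations vanish and leave no squares.\<close>

lemma pair_form_three_sites:
  assumes d: "distinct [z, x, u]"
  shows "pair_form z f x x u u + 2 * pair_form z f x u x u = 0"
    and "pair_form z f x x x u = 0"
proof -
  define h where "h A = f A * (2 * face z f x x A + 2 * face z f u u A + 4 * face z f x u A)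
     - face z f x x A * face z f u u A - 2 * (face z f x u A * face z f x u A)" for A
  define h' where "h' A = f A * (face z f x x A + 2 * face z f x u A)
     - face z f x x A * face z f x u A" for A
  define cfg where "cfg A a b c = put z a (put x b (put u c A))" for A a b c
  have sw: "swap_set z x (cfg A a b c) = cfg A b a c" "swap_set z u (cfg A a b c) = cfg A c b a"
    "swap_set x u (cfg A a b c) = cfg A a c b"
    for A a b c
    using d by (auto simp: set_eq_iff swap_set_iff cfg_def put_iff)
  have e: "(\<Sum>A\<in>UNIV. h A) = (\<Sum>A\<in>UNIV. \<Sum>a\<in>UNIV. \<Sum>b\<in>UNIV. \<Sum>c\<in>UNIV. h (cfg A a b c)) / 8"
    for h :: "'a set \<Rightarrow> real"
    unfolding cfg_def
    by (subst sum_put[where p = z], subst sum_put[where p = x], subst sum_put[where p = u])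
      (simp add: UNIV_sum_bool add_ac)
  have "pair_form z f x x u u + 2 * pair_form z f x u x u = (\<Sum>A\<in>UNIV. h A)"
    using d by (simp add: pair_form_def ip_def h_def algebra_simps sum.distrib sum_subtractf sum_distrib_left)
  also have "\<dots> = 0"
    by (subst e) (simp add: h_def face_def sw UNIV_sum_bool algebra_simps)
  finally show "pair_form z f x x u u + 2 * pair_form z f x u x u = 0" .
  have "pair_form z f x x x u = (\<Sum>A\<in>UNIV. h' A)"
    using d by (simp add: pair_form_def ip_def h'_def algebra_simps sum.distrib sum_subtractf sum_distrib_left)
  also have "\<dots> = 0"
    by (subst e) (simp add: h'_def face_def sw UNIV_sum_bool algebra_simps)
  finally show "pair_form z f x x x u = 0" .
qed

text \<open>For one leg \<open>face\<close> is \<open>2 * (1 - s)\<close> with an involution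
  \<open>s\<close>, and \<open>(1 - s)\<^sup>2 = 2 * (1 - s)\<close>.\<close>

lemma pair_form_two_sites: "pair_form z f x x x x = 0"
proof -
  have "pair_form z f x x x x
    = (\<Sum>A\<in>UNIV. 4 * (f A * face z f x x A) - face z f x x A * face z f x x A)"
    by (simp add: pair_form_def ip_def sum_subtractf flip: sum_distrib_left)
  also have "\<dots> = (\<Sum>A\<in>UNIV. 4 * (f A * f A) - 4 * (f (swap_set z x A) * f (swap_set z x A)))"
    by (rule sum.cong) (simp_all add: face_def algebra_simps)
  also have "\<dots> = 0"
    using sum_swap_set[of "\<lambda>A. f A * f A" z x]
    by (simp add: sum_subtractf flip: sum_distrib_left)
  finally show ?thesis .
qed

text \<open>The sum over the three pairings is symmetric in the four legs. Any coincidence can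
  therefore be moved to one doubled leg \<open>x\<close>, where two of the pairings agree; this is
  the auxiliary fact \<open>*\<close>.\<close>

lemma pair_form_nonneg:
  assumes "x \<noteq> z" "y \<noteq> z" "u \<noteq> z" "w \<noteq> z"
  shows "0 \<le> pair_form z f x y u w + pair_form z f x u y w + pair_form z f x w y u"
proof -
  have *: "0 \<le> pair_form z f x x u w + 2 * pair_form z f x u x w"
    if "x \<noteq> z" "u \<noteq> z" "w \<noteq> z" for x u w
  proof -
    consider "u = x" "w = x" | "u = x" "w \<noteq> x" | "u \<noteq> x" "w = x" | "u \<noteq> x" "u = w" | "u \<noteq> x" "w \<noteq> x" "u \<noteq> w"
      by blast
    then show ?thesis
    proof cases
      case 1 then show ?thesis by (simp add: pair_form_two_sites)
    next
      case 2 then show ?thesis using that pair_form_three_sites(2)[of z x w] by simp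
    next
      case 3
      then have "pair_form z f x x x u = 0" using that pair_form_three_sites(2)[of z x u] by auto
      then show ?thesis using pair_form_commute[of z f x u x x] pair_form_commute[of z f x x u x]
        pair_form_commute1[of z f x u x x] 3 by simp
    next
      case 4 then show ?thesis using that pair_form_three_sites(1)[of z x u] by simp
    next
      case 5 then show ?thesis using that pair_form_nonneg_diagonal[of z x u w f] by auto
    qed
  qed
  note c1 = pair_form_commute1[of z f] and c = pair_form_commute[of z f]
  have c2: "pair_form z f a b c d = pair_form z f a b d c" for a b c d
    using c[of a b c d] c1[of c d a b] c[of d c a b] by linarith
  consider "x = y" | "x = u" | "x = w" | "y = u" | "y = w" | "u = w" | "distinct [z, x, y, u, w]"
    using assms by auto
  then show ?thesis
  proof cases
    case 1 show ?thesis using *[of x u w] assms c2[of x w x u] c[of x u x w] unfolding 1 by linarith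
  next
    case 2 show ?thesis using *[of x y w] assms c2[of x w y x] c[of x y x w] unfolding 2 by linarith
  next
    case 3 show ?thesis using *[of x y u] assms c2[of x y u x] c2[of x u y x] c[of x y x u] unfolding 3 by linarith
  next
    case 4 show ?thesis using *[of y x w] assms c1[of x y y w] c[of x w y y] unfolding 4 by linarith
  next
    case 5 show ?thesis using *[of y x u] assms c1[of x y u y] c2[of y x u y] c1[of x y y u] c[of x u y y]
      c[of x y u y] c[of y x y u] c[of x y y u] c1[of x u y y]
      c2[of x y u y] unfolding 5 by linarith
  next
    case 6 show ?thesis using *[of u x y] assms c1[of x u y u] c2[of u x y u] c[of x y u u]
      unfolding 6 by linarith
  next
    case 7 then show ?thesis by (rule pair_form_nonneg_distinct)
  qed
qed

text \<open>This is positivity of the octopus operator after \<open>ip_face\<close> has traded inner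
  products for sums of squares. The total weight multiplies the right side instead of dividing the
  left one, which keeps vanishing weights covered.\<close>

lemma octopus_inequality:
  fixes f :: "'v::finite set \<Rightarrow> real"
  assumes z: "z \<notin> V" and c: "\<And>x. x \<in> V \<Longrightarrow> 0 \<le> c x"
  shows "(\<Sum>x\<in>V. \<Sum>y\<in>V. c x * c y * (\<Sum>A\<in>UNIV. (f A - f (swap_set x y A))\<^sup>2)) / 2
    \<le> (\<Sum>x\<in>V. c x) * (\<Sum>x\<in>V. c x * (\<Sum>A\<in>UNIV. (f A - f (swap_set z x A))\<^sup>2))"
proof -
  define D where "D x y = (\<Sum>A\<in>UNIV. (f A - f (swap_set x y A))\<^sup>2)" for x y
  \<comment> \<open>In terms of the octopus operator \<open>Q\<close>, \<open>q\<close> is twice its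
    form at \<open>f\<close>, \<open>R\<close> is \<open>2 * Q f\<close>, and \<open>K\<close> is
    \<open>(\<Sum>c)\<^sup>2 + \<Sum>c\<^sup>2\<close>.\<close>
  define q where "q = (\<Sum>x\<in>V. \<Sum>y\<in>V. c x * c y * ip f (face z f x y))"
  define K where "K = (\<Sum>x\<in>V. \<Sum>y\<in>V. c x * c y * (1 + of_bool (x = y)))"
  define R where "R A = (\<Sum>x\<in>V. \<Sum>y\<in>V. c x * c y * face z f x y A)" for A
  define P where "P x y u w = c x * c y * c u * c w * pair_form z f x y u w" for x y u w
  define S where "S F = (\<Sum>x\<in>V. \<Sum>y\<in>V. \<Sum>u\<in>V. \<Sum>w\<in>V. F x y u w)" for F :: "'v \<Rightarrow> 'v \<Rightarrow> 'v \<Rightarrow> 'v \<Rightarrow> real"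
  \<comment> \<open>The weight \<open>c x * c y * c u * c w\<close> is symmetric in the legs, so
    each of the three pairings has the same total, and nonnegativity of their sum passes to
    \<open>S P\<close>.\<close>
  have S1: "S (\<lambda>x y u w. F x u y w) = S F" for F
    unfolding S_def by (rule sum.cong[OF refl], rule sum.swap)
  have S2: "S (\<lambda>x y u w. F x y w u) = S F" for F
    unfolding S_def by (rule sum.cong[OF refl], rule sum.cong[OF refl], rule sum.swap)
  have S3: "S (\<lambda>x y u w. F x w y u) = S F" for F
    using S2[of "\<lambda>x y u w. F x u y w"] S1[of F] by simp
  have Ssplit: "S (\<lambda>x y u w. F x y * G u w) = (\<Sum>x\<in>V. \<Sum>y\<in>V. F x y) * (\<Sum>x\<in>V. \<Sum>y\<in>V. G x y)" for F G
    unfolding S_def by (simp flip: sum_distrib_left sum_distrib_right)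
  have "0 \<le> S (\<lambda>x y u w. P x y u w + P x u y w + P x w y u)"
    unfolding S_def
  proof (intro sum_nonneg)
    fix x y u w assume V: "x \<in> V" "y \<in> V" "u \<in> V" "w \<in> V"
    have "P x y u w + P x u y w + P x w y u = c x * c y * c u * c w *
       (pair_form z f x y u w + pair_form z f x u y w + pair_form z f x w y u)"
      by (simp add: P_def algebra_simps)
    also have "\<dots> \<ge> 0"
      using V z c by (intro mult_nonneg_nonneg pair_form_nonneg) auto
    finally show "0 \<le> P x y u w + P x u y w + P x w y u" .
  qed
  also have "S (\<lambda>x y u w. P x y u w + P x u y w + P x w y u)
     = S P + S (\<lambda>x y u w. P x u y w) + S (\<lambda>x y u w. P x w y u)"
    by (simp add: S_def sum.distrib)
  finally have "0 \<le> S P" by (simp only: S1[of P] S3[of P])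
  also have "S P = S (\<lambda>x y u w. (c x * c y * ip f (face z f x y)) * (c u * c w * (1 + of_bool (u = w))))
     + S (\<lambda>x y u w. (c x * c y * (1 + of_bool (x = y))) * (c u * c w * ip f (face z f u w)))
     - S (\<lambda>x y u w. c x * c y * (c u * c w) * ip (face z f x y) (face z f u w))"
  proof -
    have "S P = S (\<lambda>x y u w. (c x * c y * ip f (face z f x y)) * (c u * c w * (1 + of_bool (u = w)))
     + (c x * c y * (1 + of_bool (x = y))) * (c u * c w * ip f (face z f u w))
     - c x * c y * (c u * c w) * ip (face z f x y) (face z f u w))"
      by (rule arg_cong[of _ _ S]) (simp add: fun_eq_iff P_def pair_form_def algebra_simps)
    then show ?thesis by (simp only: S_def sum.distrib sum_subtractf)
  qed
  also have "S (\<lambda>x y u w. c x * c y * (c u * c w) * ip (face z f x y) (face z f u w)) = ip R R"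
  proof -
    have "ip R R = (\<Sum>A\<in>UNIV. S (\<lambda>x y u w. (c x * c y * face z f x y A) * (c u * c w * face z f u w A)))"
      unfolding ip_def R_def Ssplit ..
    also have "\<dots> = S (\<lambda>x y u w. \<Sum>A\<in>UNIV. (c x * c y * face z f x y A) * (c u * c w * face z f u w A))"
      unfolding S_def
      by (subst sum.swap, rule sum.cong[OF refl], subst sum.swap, rule sum.cong[OF refl],
        subst sum.swap, rule sum.cong[OF refl], subst sum.swap, rule refl)
    finally show ?thesis
      by (simp add: ip_def sum_distrib_left mult_ac)
  qed
  finally have le: "ip R R \<le> 2 * K * q"
    unfolding Ssplit by (simp add: K_def q_def)
  have "0 \<le> ip R R" unfolding ip_def by (intro sum_nonneg) auto
  with le have Kq: "0 \<le> K * q" by simp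
  \<comment> \<open>If \<open>K\<close> is not positive, its diagonal terms force every weight to be
    zero, and then \<open>q\<close> is zero as well.\<close>
  have "0 \<le> q"
  proof (cases "K > 0")
    case True then show ?thesis using Kq by (simp add: zero_le_mult_iff)
  next
    case False
    have "c x = 0" if "x \<in> V" for x
    proof -
      have "(c x)\<^sup>2 \<le> c x * c x * (1 + of_bool (x = x))" by (simp add: power2_eq_square)
      also have "\<dots> \<le> (\<Sum>y\<in>V. c x * c y * (1 + of_bool (x = y)))"
        by (rule member_le_sum[OF that]) (auto simp: c that)
      also have "\<dots> \<le> K"
        unfolding K_def
        by (rule member_le_sum[OF that]) (auto simp: c that intro!: sum_nonneg)
      finally show ?thesis using False by (smt (verit) zero_less_power2)
    qed
    then show ?thesis by (simp add: q_def)
  qed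
  also have "q = (\<Sum>x\<in>V. \<Sum>y\<in>V. c x * c y * (D z x + D z y - D x y) / 2)"
    by (simp add: q_def ip_face D_def)
  also have "\<dots> = (\<Sum>x\<in>V. \<Sum>y\<in>V. (c x * D z x) * c y) / 2 + (\<Sum>x\<in>V. \<Sum>y\<in>V. c x * (c y * D z y)) / 2
     - (\<Sum>x\<in>V. \<Sum>y\<in>V. c x * c y * D x y) / 2"
    by (simp only: sum_divide_distrib flip: sum.distrib sum_subtractf)
      (rule sum.cong[OF refl], rule sum.cong[OF refl], simp add: field_simps)
  also have "\<dots> = (\<Sum>x\<in>V. c x) * (\<Sum>x\<in>V. c x * D z x) - (\<Sum>x\<in>V. \<Sum>y\<in>V. c x * c y * D x y) / 2"
    by (simp only: mult.commute[of "sum c V"] flip: sum_distrib_left sum_distrib_right)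
  finally show ?thesis by (simp add: D_def)
qed

section \<open>The spectral gap of the exclusion process\<close>

definition confs :: "'v set \<Rightarrow> nat \<Rightarrow> 'v set set" where
  "confs W k = {A. A \<subseteq> W \<and> card A = k}"

text \<open>Every transition is met four times, from the two orders of its sites and from its two
  end configurations; hence the 4, against 2 in \<open>walk_form\<close>.\<close>

definition excl_form :: "('v \<Rightarrow> 'v \<Rightarrow> real) \<Rightarrow> 'v set \<Rightarrow> nat \<Rightarrow> ('v set \<Rightarrow> real) \<Rightarrow> real" where
  "excl_form c W k f =
    (\<Sum>x\<in>W. \<Sum>y\<in>W. c x y * (\<Sum>A\<in>confs W k. (f A - f (swap_set x y A))\<^sup>2)) / 4"

definition walk_form :: "('v \<Rightarrow> 'v \<Rightarrow> real) \<Rightarrow> 'v set \<Rightarrow> ('v \<Rightarrow> real) \<Rightarrow> real" where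
  "walk_form c W g = (\<Sum>x\<in>W. \<Sum>y\<in>W. c x y * (g x - g y)\<^sup>2) / 2"

lemma finite_confs [simp]: "finite W \<Longrightarrow> finite (confs W k)"
  by (simp add: confs_def)

lemma swap_set_confs: "x \<in> W \<Longrightarrow> y \<in> W \<Longrightarrow> swap_set x y A \<in> confs W k \<longleftrightarrow> A \<in> confs W k"
  by (auto simp: confs_def subset_iff swap_set_iff)

lemma sum_confs_swap:
  assumes "x \<in> W" "y \<in> W"
  shows "(\<Sum>A\<in>confs W k. h (swap_set x y A)) = (\<Sum>A\<in>confs W k. h A)"
proof -
  have "bij_betw (swap_set x y) (confs W k) (confs W k)"
    by (rule bij_betw_byWitness[where f' = "swap_set x y"]) (auto simp: swap_set_confs assms)
  then show ?thesis by (rule sum.reindex_bij_betw)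
qed

lemma confs_remove:
  assumes "z \<in> W" "k \<ge> 1" "finite W"
  shows "{A \<in> confs W k. z \<notin> A} = confs (W - {z}) k"
    and "{A \<in> confs W k. z \<in> A} = insert z ` confs (W - {z}) (k - 1)"
proof -
  show "{A \<in> confs W k. z \<notin> A} = confs (W - {z}) k" by (auto simp: confs_def)
  show "{A \<in> confs W k. z \<in> A} = insert z ` confs (W - {z}) (k - 1)"
  proof (intro set_eqI iffI)
    fix A assume A: "A \<in> {A \<in> confs W k. z \<in> A}"
    then have "finite A" using assms by (auto simp: confs_def finite_subset)
    then have "A = insert z (A - {z})" "A - {z} \<in> confs (W - {z}) (k - 1)"
      using A by (auto simp: confs_def)
    then show "A \<in> insert z ` confs (W - {z}) (k - 1)" by blast
  next
    fix A assume "A \<in> insert z ` confs (W - {z}) (k - 1)"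
    then obtain B where B: "A = insert z B" "B \<subseteq> W - {z}" "card B = k - 1" by (auto simp: confs_def)
    then have "finite B" "z \<notin> B" using assms by (auto intro: finite_subset)
    then show "A \<in> {A \<in> confs W k. z \<in> A}" using B assms by (auto simp: confs_def)
  qed
qed

lemma inj_on_insert_confs: "inj_on (insert z) (confs (W - {z}) k)"
  by (auto simp: inj_on_def confs_def)

lemma sum_confs_remove:
  fixes h :: "'v set \<Rightarrow> real"
  assumes "z \<in> W" "k \<ge> 1" "finite W"
  shows "(\<Sum>A\<in>confs W k. h A) = (\<Sum>A\<in>confs (W - {z}) k. h A) + (\<Sum>A\<in>confs (W - {z}) (k - 1). h (insert z A))"
    and "(\<Sum>A\<in>confs (W - {z}) (k - 1). h (insert z A)) = (\<Sum>A\<in>{A \<in> confs W k. z \<in> A}. h A)"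
proof -
  show 2: "(\<Sum>A\<in>confs (W - {z}) (k - 1). h (insert z A)) = (\<Sum>A\<in>{A \<in> confs W k. z \<in> A}. h A)"
    unfolding confs_remove[OF assms] by (simp add: sum.reindex inj_on_insert_confs)
  have "(\<Sum>A\<in>confs W k. h A) = (\<Sum>A\<in>{A \<in> confs W k. z \<notin> A} \<union> {A \<in> confs W k. z \<in> A}. h A)"
    by (rule sum.cong) auto
  also have "\<dots> = (\<Sum>A\<in>{A \<in> confs W k. z \<notin> A}. h A) + (\<Sum>A\<in>{A \<in> confs W k. z \<in> A}. h A)"
    by (rule sum.union_disjoint) (auto simp: assms)
  finally show "(\<Sum>A\<in>confs W k. h A) = (\<Sum>A\<in>confs (W - {z}) k. h A) + (\<Sum>A\<in>confs (W - {z}) (k - 1). h (insert z A))"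
    unfolding 2 confs_remove(1)[OF assms] .
qed

section \<open>Functions linear in the occupation numbers\<close>

lemma card_confs_separate:
  assumes "finite W" "x \<in> W" "y \<in> W" "x \<noteq> y" "k \<ge> 1"
  shows "card {A \<in> confs W k. x \<in> A \<and> y \<notin> A} = (card W - 2) choose (k - 1)"
proof -
  have "{A \<in> confs W k. x \<in> A \<and> y \<notin> A} = {A \<in> confs (W - {y}) k. x \<in> A}"
    by (auto simp: confs_def)
  also have "\<dots> = insert x ` confs (W - {y} - {x}) (k - 1)"
    using assms by (intro confs_remove) auto
  finally have "card {A \<in> confs W k. x \<in> A \<and> y \<notin> A} = card (confs (W - {y} - {x}) (k - 1))"
    by (simp add: card_image inj_on_insert_confs)
  also have "\<dots> = card (W - {y} - {x}) choose (k - 1)"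
    unfolding confs_def using assms by (intro n_subsets) auto
  also have "card (W - {y} - {x}) = card W - 2" using assms by simp
  finally show ?thesis .
qed

text \<open>An exchange of two sums. It says that lifting \<open>a\<close> to \<open>sum a\<close>
  is adjoint to taking the marginals of \<open>f\<close>.\<close>

lemma sum_marginals:
  fixes f :: "'v set \<Rightarrow> real"
  assumes "finite W"
  shows "(\<Sum>x\<in>W. a x * (\<Sum>A\<in>{A \<in> confs W k. x \<in> A}. f A)) = (\<Sum>A\<in>confs W k. (\<Sum>x\<in>A. a x) * f A)"
proof -
  have "(\<Sum>x\<in>W. a x * (\<Sum>A\<in>{A \<in> confs W k. x \<in> A}. f A)) = (\<Sum>x\<in>W. \<Sum>A\<in>{A \<in> confs W k. x \<in> A}. a x * f A)"
    by (simp add: sum_distrib_left)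
  also have "\<dots> = (\<Sum>A\<in>confs W k. \<Sum>x\<in>{x \<in> W. x \<in> A}. a x * f A)"
    using assms by (intro sum.swap_restrict) auto
  also have "\<dots> = (\<Sum>A\<in>confs W k. (\<Sum>x\<in>A. a x) * f A)"
  proof (rule sum.cong[OF refl])
    fix A assume "A \<in> confs W k"
    then have "{x \<in> W. x \<in> A} = A" by (auto simp: confs_def)
    then show "(\<Sum>x\<in>{x \<in> W. x \<in> A}. a x * f A) = (\<Sum>x\<in>A. a x) * f A" by (simp add: sum_distrib_right)
  qed
  finally show ?thesis .
qed

text \<open>Configurations containing \<open>x\<close> contain \<open>y\<close> unless they separate
  the two. The common count drops out since \<open>a\<close> has sum zero, the separating count is
  the same for all \<open>y \<noteq> x\<close>, and the values of \<open>a\<close> off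
  \<open>x\<close> add up to \<open>- a x\<close>.\<close>

lemma marginal_lift:
  fixes a :: "'v \<Rightarrow> real"
  assumes "finite W" "x \<in> W" "k \<ge> 1" and a: "(\<Sum>y\<in>W. a y) = 0"
  shows "(\<Sum>A\<in>{A \<in> confs W k. x \<in> A}. \<Sum>y\<in>A. a y) = real ((card W - 2) choose (k - 1)) * a x"
proof -
  let ?C = "{A \<in> confs W k. x \<in> A}"
  have fin: "finite ?C" using assms by simp
  have split: "real (card {A \<in> ?C. y \<in> A}) = real (card ?C) - real (card {A \<in> confs W k. x \<in> A \<and> y \<notin> A})" for y
  proof -
    have "card ?C = card ({A \<in> ?C. y \<in> A} \<union> {A \<in> confs W k. x \<in> A \<and> y \<notin> A})"
      by (rule arg_cong[of _ _ card]) auto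
    also have "\<dots> = card {A \<in> ?C. y \<in> A} + card {A \<in> confs W k. x \<in> A \<and> y \<notin> A}"
      using assms(1) by (intro card_Un_disjoint) auto
    finally have "card ?C = card {A \<in> ?C. y \<in> A} + card {A \<in> confs W k. x \<in> A \<and> y \<notin> A}" .
    then show ?thesis by simp
  qed
  have "(\<Sum>A\<in>?C. \<Sum>y\<in>A. a y) = (\<Sum>A\<in>?C. \<Sum>y\<in>{y \<in> W. y \<in> A}. a y)"
    by (intro sum.cong) (auto simp: confs_def)
  also have "\<dots> = (\<Sum>y\<in>W. \<Sum>A\<in>{A \<in> ?C. y \<in> A}. a y)"
    using assms fin by (intro sum.swap_restrict) auto
  also have "\<dots> = (\<Sum>y\<in>W. a y * real (card ?C) - a y * real (card {A \<in> confs W k. x \<in> A \<and> y \<notin> A}))"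
    by (simp only: sum_constant split) (simp add: algebra_simps)
  also have "\<dots> = - (\<Sum>y\<in>W. a y * real (card {A \<in> confs W k. x \<in> A \<and> y \<notin> A}))"
    using a by (simp add: sum_subtractf flip: sum_distrib_right)
  also have "(\<Sum>y\<in>W. a y * real (card {A \<in> confs W k. x \<in> A \<and> y \<notin> A}))
     = (\<Sum>y\<in>W - {x}. a y * real ((card W - 2) choose (k - 1)))"
  proof -
    have "card {A \<in> confs W k. x \<in> A \<and> y \<notin> A} = (card W - 2) choose (k - 1)" if "y \<in> W - {x}" for y
      using card_confs_separate[of W x y k] assms that by auto
    then show ?thesis
      using assms by (subst sum.remove[of _ x]) auto
  qed
  also have "(\<Sum>y\<in>W - {x}. a y * real ((card W - 2) choose (k - 1))) = - a x * real ((card W - 2) choose (k - 1))"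
    using a assms by (simp add: sum_diff1 flip: sum_distrib_right)
  finally show ?thesis by simp
qed

lemma lift_swap:
  fixes a :: "'v \<Rightarrow> real"
  assumes "finite A"
  shows "(\<Sum>p\<in>A. a p) - (\<Sum>p\<in>swap_set x y A. a p) = (a x - a y) * (of_bool (x \<in> A) - of_bool (y \<in> A))"
proof (cases "x \<in> A \<longleftrightarrow> y \<in> A")
  case True
  then have "swap_set x y A = A" by (auto simp: swap_set_iff split: if_splits)
  then show ?thesis using True by simp
next
  case False
  define B where "B = A - {x, y}"
  have B: "x \<notin> B" "y \<notin> B" "finite B" "x \<noteq> y" using assms False by (auto simp: B_def)
  have "A = insert x B \<and> swap_set x y A = insert y B \<and> x \<in> A \<and> y \<notin> A
      \<or> A = insert y B \<and> swap_set x y A = insert x B \<and> x \<notin> A \<and> y \<in> A"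
  proof (cases "x \<in> A")
    case True
    then have "A = insert x B" "swap_set x y A = insert y B" "y \<notin> A"
      using False by (auto simp: B_def swap_set_iff split: if_splits)
    then show ?thesis using True by blast
  next
    case F: False
    then have "A = insert y B" "swap_set x y A = insert x B" "y \<in> A"
      using False by (auto simp: B_def swap_set_iff split: if_splits)
    then show ?thesis using F by blast
  qed
  then show ?thesis
  proof (elim disjE conjE)
    assume *: "A = insert x B" "swap_set x y A = insert y B" "x \<in> A" "y \<notin> A"
    show ?thesis unfolding *(2) using *(3,4) *(1) B by simp
  next
    assume *: "A = insert y B" "swap_set x y A = insert x B" "x \<notin> A" "y \<in> A"
    show ?thesis unfolding *(2) using *(3,4) *(1) B by simp
  qed
qed

lemma excl_form_nonneg: "(\<And>x y. 0 \<le> c x y) \<Longrightarrow> 0 \<le> excl_form c W k f"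
  unfolding excl_form_def by (intro divide_nonneg_pos sum_nonneg mult_nonneg_nonneg) auto

text \<open>By \<open>lift_swap\<close>, the increment of a linear function along a swap is a
  combination of two occupation numbers. The cross terms are therefore marginals of
  \<open>f2\<close>, which vanish.\<close>

lemma excl_form_orthogonal:
  fixes a :: "'v \<Rightarrow> real"
  assumes W: "finite W" and f2: "\<And>x. x \<in> W \<Longrightarrow> (\<Sum>A\<in>{A \<in> confs W k. x \<in> A}. f2 A) = 0"
  shows "excl_form c W k (\<lambda>A. sum a A + f2 A) = excl_form c W k (sum a) + excl_form c W k f2"
proof -
  have cross: "(\<Sum>A\<in>confs W k. (sum a A - sum a (swap_set x y A)) * (f2 A - f2 (swap_set x y A))) = 0"
    if xy: "x \<in> W" "y \<in> W" for x y
  proof -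
    have z: "(\<Sum>A\<in>confs W k. (sum a A - sum a (swap_set x y A)) * f2 A) = 0"
    proof -
      have "(\<Sum>A\<in>confs W k. (sum a A - sum a (swap_set x y A)) * f2 A)
        = (\<Sum>A\<in>confs W k. (a x - a y) * ((if x \<in> A then f2 A else 0) - (if y \<in> A then f2 A else 0)))"
      proof (rule sum.cong[OF refl])
        fix A assume "A \<in> confs W k"
        then have "finite A" using W by (auto simp: confs_def finite_subset)
        then show "(sum a A - sum a (swap_set x y A)) * f2 A
            = (a x - a y) * ((if x \<in> A then f2 A else 0) - (if y \<in> A then f2 A else 0))"
          by (simp add: lift_swap)
      qed
      also have "\<dots> = (a x - a y) * ((\<Sum>A\<in>{A \<in> confs W k. x \<in> A}. f2 A) - (\<Sum>A\<in>{A \<in> confs W k. y \<in> A}. f2 A))"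
        using W by (simp add: sum_subtractf sum.inter_filter flip: sum_distrib_left)
      finally show ?thesis using f2 xy by simp
    qed
    have "(\<Sum>A\<in>confs W k. (sum a A - sum a (swap_set x y A)) * f2 (swap_set x y A))
      = (\<Sum>A\<in>confs W k. (sum a (swap_set x y A) - sum a A) * f2 A)"
      using sum_confs_swap[OF xy, of "\<lambda>A. (sum a (swap_set x y A) - sum a A) * f2 A" k] by simp
    also have "\<dots> = - (\<Sum>A\<in>confs W k. (sum a A - sum a (swap_set x y A)) * f2 A)"
      by (simp add: algebra_simps flip: sum_negf)
    finally show ?thesis using z by (simp add: right_diff_distrib sum_subtractf)
  qed
  have "(\<Sum>A\<in>confs W k. (sum a A + f2 A - (sum a (swap_set x y A) + f2 (swap_set x y A)))\<^sup>2)
    = (\<Sum>A\<in>confs W k. (sum a A - sum a (swap_set x y A))\<^sup>2) + (\<Sum>A\<in>confs W k. (f2 A - f2 (swap_set x y A))\<^sup>2)"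
    if xy: "x \<in> W" "y \<in> W" for x y
  proof -
    have "(\<Sum>A\<in>confs W k. (sum a A + f2 A - (sum a (swap_set x y A) + f2 (swap_set x y A)))\<^sup>2)
      = (\<Sum>A\<in>confs W k. (sum a A - sum a (swap_set x y A))\<^sup>2 + (f2 A - f2 (swap_set x y A))\<^sup>2
         + 2 * ((sum a A - sum a (swap_set x y A)) * (f2 A - f2 (swap_set x y A))))"
      by (rule sum.cong[OF refl]) (simp add: power2_eq_square algebra_simps)
    then show ?thesis using cross[OF xy] by (simp add: sum.distrib flip: sum_distrib_left)
  qed
  then show ?thesis
    by (simp add: excl_form_def distrib_left sum.distrib add_divide_distrib cong: sum.cong)
qed

lemma norm_orthogonal:
  fixes a :: "'v \<Rightarrow> real"
  assumes W: "finite W" and f2: "\<And>x. x \<in> W \<Longrightarrow> (\<Sum>A\<in>{A \<in> confs W k. x \<in> A}. f2 A) = 0"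
  shows "(\<Sum>A\<in>confs W k. (sum a A + f2 A)\<^sup>2) = (\<Sum>A\<in>confs W k. (sum a A)\<^sup>2) + (\<Sum>A\<in>confs W k. (f2 A)\<^sup>2)"
proof -
  have "(\<Sum>A\<in>confs W k. sum a A * f2 A) = 0"
    using sum_marginals[OF W, where a = a and f = f2 and k = k] f2 by simp
  then have "(\<Sum>A\<in>confs W k. 2 * sum a A * f2 A) = 0" by (simp add: mult.assoc flip: sum_distrib_left)
  then show ?thesis by (simp add: power2_sum sum.distrib)
qed

lemma norm_lift:
  fixes a :: "'v \<Rightarrow> real"
  assumes "finite W" "k \<ge> 1" "(\<Sum>y\<in>W. a y) = 0"
  shows "(\<Sum>A\<in>confs W k. (sum a A)\<^sup>2) = real ((card W - 2) choose (k - 1)) * (\<Sum>x\<in>W. (a x)\<^sup>2)"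
proof -
  have "(\<Sum>A\<in>confs W k. (sum a A)\<^sup>2) = (\<Sum>x\<in>W. a x * (\<Sum>A\<in>{A \<in> confs W k. x \<in> A}. sum a A))"
    using assms by (simp add: sum_marginals power2_eq_square)
  also have "\<dots> = (\<Sum>x\<in>W. a x * (real ((card W - 2) choose (k - 1)) * a x))"
    by (rule sum.cong[OF refl]) (simp only: marginal_lift assms)
  also have "\<dots> = real ((card W - 2) choose (k - 1)) * (\<Sum>x\<in>W. (a x)\<^sup>2)"
    unfolding sum_distrib_left by (rule sum.cong) (simp_all add: power2_eq_square)
  finally show ?thesis .
qed

text \<open>Along a swap the linear function changes by \<open>a x - a y\<close> up to sign, and
  only on configurations that separate the two sites. Their number gives the same binomial factor as
  in \<open>norm_lift\<close>, so for coefficients of sum zero the Rayleigh quotients are those of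
  the walk.\<close>

lemma excl_form_lift:
  fixes a :: "'v \<Rightarrow> real"
  assumes W: "finite W" and k: "k \<ge> 1"
  shows "excl_form c W k (sum a) = real ((card W - 2) choose (k - 1)) * walk_form c W a"
proof -
  let ?N = "real ((card W - 2) choose (k - 1))"
  have "(\<Sum>A\<in>confs W k. (sum a A - sum a (swap_set x y A))\<^sup>2) = 2 * ?N * (a x - a y)\<^sup>2"
    if xy: "x \<in> W" "y \<in> W" for x y
  proof (cases "x = y")
    case False
    have "(\<Sum>A\<in>confs W k. (sum a A - sum a (swap_set x y A))\<^sup>2)
      = (\<Sum>A\<in>confs W k. (a x - a y)\<^sup>2 * (of_bool (x \<in> A \<and> y \<notin> A) + of_bool (y \<in> A \<and> x \<notin> A)))"
    proof (rule sum.cong[OF refl])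
      fix A assume "A \<in> confs W k"
      then have "finite A" using W by (auto simp: confs_def finite_subset)
      then show "(sum a A - sum a (swap_set x y A))\<^sup>2
        = (a x - a y)\<^sup>2 * (of_bool (x \<in> A \<and> y \<notin> A) + of_bool (y \<in> A \<and> x \<notin> A))"
        by (auto simp: lift_swap power2_commute)
    qed
    also have "\<dots> = (a x - a y)\<^sup>2 * (real (card {A \<in> confs W k. x \<in> A \<and> y \<notin> A})
       + real (card {A \<in> confs W k. y \<in> A \<and> x \<notin> A}))"
      using W by (simp add: sum.distrib Int_def flip: sum_distrib_left)
    finally show ?thesis
      using False xy W k card_confs_separate[of W x y k] card_confs_separate[of W y x k] by simp
  qed simp
  then have "excl_form c W k (sum a) = (\<Sum>x\<in>W. \<Sum>y\<in>W. c x y * (2 * ?N * (a x - a y)\<^sup>2)) / 4"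
    by (simp add: excl_form_def cong: sum.cong)
  also have "\<dots> = ?N * walk_form c W a"
    by (simp add: walk_form_def sum_distrib_left mult_ac sum_divide_distrib)
  finally show ?thesis .
qed

text \<open>The star-mesh transform, which is the Schur complement of the Laplacian at
  \<open>z\<close>. If all rates from \<open>z\<close> to the rest vanish, division by zero yields 0
  and the rates are left as they are.\<close>

definition star_reduce :: "('v \<Rightarrow> 'v \<Rightarrow> real) \<Rightarrow> 'v set \<Rightarrow> 'v \<Rightarrow> 'v \<Rightarrow> 'v \<Rightarrow> real" where
  "star_reduce c W z x y = c x y + c z x * c z y / (\<Sum>p\<in>W - {z}. c z p)"

lemma sum_sum_remove:
  fixes h :: "'v \<Rightarrow> 'v \<Rightarrow> real"
  assumes "finite W" "z \<in> W" "\<And>x y. h x y = h y x" "h z z = 0"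
  shows "(\<Sum>x\<in>W. \<Sum>y\<in>W. h x y) = (\<Sum>x\<in>W-{z}. \<Sum>y\<in>W-{z}. h x y) + 2 * (\<Sum>x\<in>W-{z}. h z x)"
proof -
  have *: "(\<Sum>y\<in>W. g y) = g z + (\<Sum>y\<in>W-{z}. g y)" for g :: "'v \<Rightarrow> real"
    using assms by (simp add: sum.remove)
  have "(\<Sum>x\<in>W. \<Sum>y\<in>W. h x y) = (\<Sum>y\<in>W-{z}. h z y) + (\<Sum>x\<in>W-{z}. h x z + (\<Sum>y\<in>W-{z}. h x y))"
    unfolding *[of "\<lambda>x. \<Sum>y\<in>W. h x y"] unfolding * using assms by simp
  also have "(\<Sum>x\<in>W-{z}. h x z + (\<Sum>y\<in>W-{z}. h x y)) = (\<Sum>x\<in>W-{z}. h z x) + (\<Sum>x\<in>W-{z}. \<Sum>y\<in>W-{z}. h x y)"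
    using assms(3)[of _ z] by (simp add: sum.distrib)
  finally show ?thesis by simp
qed

text \<open>For swaps inside \<open>W - {z}\<close> the form splits according to the occupation of
  \<open>z\<close>. The rates created by the star-mesh transform are then paid for by the edges at
  \<open>z\<close>: taken over both halves together, this is the octopus inequality.\<close>

lemma excl_form_star_reduce:
  fixes f :: "'v::finite set \<Rightarrow> real"
  assumes sym: "\<And>x y. c x y = c y x" and c: "\<And>x y. 0 \<le> c x y" and z: "z \<in> W" and k: "k \<ge> 1"
  shows "excl_form (star_reduce c W z) (W - {z}) k f
    + excl_form (star_reduce c W z) (W - {z}) (k - 1) (\<lambda>A. f (insert z A)) \<le> excl_form c W k f"
proof -
  let ?V = "W - {z}"
  define C where "C = (\<Sum>p\<in>?V. c z p)"
  define D where "D x y = (\<Sum>A\<in>confs W k. (f A - f (swap_set x y A))\<^sup>2)" for x y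
  have Dsym: "D x y = D y x" for x y by (simp add: D_def swap_set_commute[of x y])
  have Dnn: "0 \<le> D x y" for x y unfolding D_def by (intro sum_nonneg) auto
  have C0: "0 \<le> C" unfolding C_def by (intro sum_nonneg c)
  have split: "(\<Sum>A\<in>confs ?V k. (f A - f (swap_set x y A))\<^sup>2)
     + (\<Sum>A\<in>confs ?V (k - 1). (f (insert z A) - f (insert z (swap_set x y A)))\<^sup>2) = D x y"
    if "x \<in> ?V" "y \<in> ?V" for x y
  proof -
    have "insert z (swap_set x y A) = swap_set x y (insert z A)" for A
      using that by (auto simp: swap_set_iff split: if_splits)
    then show ?thesis
      unfolding D_def using sum_confs_remove(1)[OF z k, of "\<lambda>A. (f A - f (swap_set x y A))\<^sup>2"] by simp
  qed
  have oct: "(\<Sum>x\<in>?V. \<Sum>y\<in>?V. c z x * c z y * D x y) / 2 \<le> C * (\<Sum>x\<in>?V. c z x * D z x)"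
  proof -
    \<comment> \<open>The octopus inequality sums over all sets. Extension by zero is compatible
      with it because swaps inside \<open>W\<close> preserve \<open>confs W k\<close>.\<close>
    define f' where "f' A = (if A \<in> confs W k then f A else 0)" for A
    have eq: "(\<Sum>A\<in>UNIV. (f' A - f' (swap_set x y A))\<^sup>2) = D x y" if "x \<in> W" "y \<in> W" for x y
    proof -
      have "(\<Sum>A\<in>UNIV. (f' A - f' (swap_set x y A))\<^sup>2) = (\<Sum>A\<in>confs W k. (f' A - f' (swap_set x y A))\<^sup>2)"
        using that by (intro sum.mono_neutral_right) (auto simp: f'_def swap_set_confs)
      also have "\<dots> = D x y" unfolding D_def
        using that by (intro sum.cong) (auto simp: f'_def swap_set_confs)
      finally show ?thesis .
    qed
    have "(\<Sum>x\<in>?V. \<Sum>y\<in>?V. c z x * c z y * (\<Sum>A\<in>UNIV. (f' A - f' (swap_set x y A))\<^sup>2))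
        = (\<Sum>x\<in>?V. \<Sum>y\<in>?V. c z x * c z y * D x y)"
      by (intro sum.cong refl) (simp add: eq)
    moreover have "(\<Sum>x\<in>?V. c z x * (\<Sum>A\<in>UNIV. (f' A - f' (swap_set z x A))\<^sup>2)) = (\<Sum>x\<in>?V. c z x * D z x)"
      using z by (intro sum.cong refl) (simp add: eq)
    ultimately show ?thesis
      using octopus_inequality[of z ?V "c z" f'] c by (simp add: C_def)
  qed
  have oct': "(\<Sum>x\<in>?V. \<Sum>y\<in>?V. c z x * c z y / C * D x y) \<le> 2 * (\<Sum>x\<in>?V. c z x * D z x)"
  proof (cases "C = 0")
    \<comment> \<open>The quotients are 0 by convention, and the right side is nonnegative.\<close>
    case True
    then show ?thesis by (auto intro!: sum_nonneg mult_nonneg_nonneg c Dnn)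
  next
    case False
    then have "C > 0" using C0 by simp
    have "(\<Sum>x\<in>?V. \<Sum>y\<in>?V. c z x * c z y / C * D x y) = (\<Sum>x\<in>?V. \<Sum>y\<in>?V. c z x * c z y * D x y) / C"
      by (simp add: sum_divide_distrib)
    also have "\<dots> \<le> 2 * (\<Sum>x\<in>?V. c z x * D z x)"
      unfolding pos_divide_le_eq[OF \<open>C > 0\<close>] using oct
      by (simp only: mult.assoc mult.commute[of _ C])
    finally show ?thesis .
  qed
  have "(\<Sum>x\<in>?V. \<Sum>y\<in>?V. star_reduce c W z x y * D x y)
    = (\<Sum>x\<in>?V. \<Sum>y\<in>?V. star_reduce c W z x y * ((\<Sum>A\<in>confs ?V k. (f A - f (swap_set x y A))\<^sup>2)
     + (\<Sum>A\<in>confs ?V (k - 1). (f (insert z A) - f (insert z (swap_set x y A)))\<^sup>2)))"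
    by (intro sum.cong refl) (simp only: split)
  then have "excl_form (star_reduce c W z) ?V k f + excl_form (star_reduce c W z) ?V (k - 1) (\<lambda>A. f (insert z A))
     = (\<Sum>x\<in>?V. \<Sum>y\<in>?V. star_reduce c W z x y * D x y) / 4"
    by (simp only: excl_form_def distrib_left sum.distrib add_divide_distrib)
  also have "\<dots> = ((\<Sum>x\<in>?V. \<Sum>y\<in>?V. c x y * D x y) + (\<Sum>x\<in>?V. \<Sum>y\<in>?V. c z x * c z y / C * D x y)) / 4"
    by (simp add: star_reduce_def distrib_right sum.distrib C_def)
  also have "\<dots> \<le> ((\<Sum>x\<in>?V. \<Sum>y\<in>?V. c x y * D x y) + 2 * (\<Sum>x\<in>?V. c z x * D z x)) / 4"
    using oct' by simp
  also have "\<dots> = (\<Sum>x\<in>W. \<Sum>y\<in>W. c x y * D x y) / 4"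
    using z sym Dsym by (subst sum_sum_remove[of W z]) (auto simp: D_def)
  finally show ?thesis by (simp add: excl_form_def D_def)
qed

text \<open>The value \<open>h\<close> is the mean of \<open>g\<close> weighted by the rates at
  \<open>z\<close>, its harmonic extension. A weighted variance equals half the weighted sum over
  pairs of squared differences, divided by the total weight; these pair weights are the new
  rates.\<close>

lemma walk_form_star_reduce:
  fixes g :: "'v::finite \<Rightarrow> real"
  assumes sym: "\<And>x y. c x y = c y x" and c: "\<And>x y. 0 \<le> c x y" and z: "z \<in> W"
  obtains h where "walk_form c W (\<lambda>x. if x = z then h else g x) = walk_form (star_reduce c W z) (W - {z}) g"
proof -
  let ?V = "W - {z}"
  define C where "C = (\<Sum>p\<in>?V. c z p)"
  define h where "h = (\<Sum>p\<in>?V. c z p * g p) / C"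
  let ?g = "\<lambda>x. if x = z then h else g x"
  have "walk_form c W ?g = (\<Sum>x\<in>?V. \<Sum>y\<in>?V. c x y * (?g x - ?g y)\<^sup>2) / 2 + (\<Sum>x\<in>?V. c z x * (?g z - ?g x)\<^sup>2)"
    unfolding walk_form_def
    using z sym by (subst sum_sum_remove[of W z]) (auto simp: power2_commute)
  also have "\<dots> = (\<Sum>x\<in>?V. \<Sum>y\<in>?V. c x y * (g x - g y)\<^sup>2) / 2 + (\<Sum>x\<in>?V. c z x * (h - g x)\<^sup>2)"
  proof -
    have "(\<Sum>x\<in>?V. \<Sum>y\<in>?V. c x y * (?g x - ?g y)\<^sup>2) = (\<Sum>x\<in>?V. \<Sum>y\<in>?V. c x y * (g x - g y)\<^sup>2)"
      by (intro sum.cong refl) auto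
    moreover have "(\<Sum>x\<in>?V. c z x * (?g z - ?g x)\<^sup>2) = (\<Sum>x\<in>?V. c z x * (h - g x)\<^sup>2)"
      by (intro sum.cong refl) auto
    ultimately show ?thesis by simp
  qed
  also have "(\<Sum>x\<in>?V. c z x * (h - g x)\<^sup>2) = (\<Sum>x\<in>?V. \<Sum>y\<in>?V. c z x * c z y / C * (g x - g y)\<^sup>2) / 2"
  proof (cases "C = 0")
    case True
    then have "\<forall>x\<in>?V. c z x = 0"
      unfolding C_def by (subst (asm) sum_nonneg_eq_0_iff) (auto simp: c)
    then show ?thesis by simp
  next
    case False
    define m where "m = (\<Sum>p\<in>?V. c z p * g p)"
    define s where "s = (\<Sum>p\<in>?V. c z p * (g p)\<^sup>2)"
    have hm: "h = m / C" by (simp add: h_def m_def)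
    have "(\<Sum>x\<in>?V. c z x * (h - g x)\<^sup>2) = (\<Sum>x\<in>?V. c z x * h\<^sup>2 - c z x * g x * (2 * h) + c z x * (g x)\<^sup>2)"
      by (rule sum.cong) (auto simp: power2_eq_square algebra_simps)
    also have "\<dots> = C * h\<^sup>2 - m * (2 * h) + s"
      by (simp add: sum.distrib sum_subtractf C_def m_def s_def flip: sum_distrib_right)
    finally have 1: "(\<Sum>x\<in>?V. c z x * (h - g x)\<^sup>2) = s - m\<^sup>2 / C"
      using False by (simp add: hm power2_eq_square field_simps)
    have "(\<Sum>x\<in>?V. \<Sum>y\<in>?V. c z x * c z y / C * (g x - g y)\<^sup>2)
      = (\<Sum>x\<in>?V. \<Sum>y\<in>?V. (c z x * (g x)\<^sup>2) * c z y + c z x * (c z y * (g y)\<^sup>2) - 2 * ((c z x * g x) * (c z y * g y))) / C"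
      unfolding sum_divide_distrib
      by (rule sum.cong[OF refl], rule sum.cong[OF refl]) (simp add: power2_eq_square field_simps)
    also have "(\<Sum>x\<in>?V. \<Sum>y\<in>?V. (c z x * (g x)\<^sup>2) * c z y + c z x * (c z y * (g y)\<^sup>2) - 2 * ((c z x * g x) * (c z y * g y)))
      = s * C + C * s - 2 * (m * m)"
      unfolding sum.distrib sum_subtractf sum_distrib_left[symmetric] sum_distrib_right[symmetric] C_def m_def s_def ..
    finally show ?thesis
      unfolding 1 using False by (simp add: power2_eq_square field_simps)
  qed
  also have "(\<Sum>x\<in>?V. \<Sum>y\<in>?V. c x y * (g x - g y)\<^sup>2) / 2 + \<dots> = walk_form (star_reduce c W z) ?V g"
    by (simp add: walk_form_def star_reduce_def C_def distrib_right sum.distrib add_divide_distrib)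
  finally show ?thesis by (rule that)
qed

lemma walk_form_shift: "walk_form c W (\<lambda>x. g x - s) = walk_form c W g"
  by (simp add: walk_form_def)

text \<open>Extend \<open>g\<close> harmonically to \<open>z\<close> and subtract the mean
  \<open>h / n\<close>. The shift does not change the form, and the recentred extension exceeds
  \<open>g\<close> in squared norm by \<open>h\<^sup>2 * (1 - 1 / n)\<close>, which is
  nonnegative.\<close>

lemma walk_gap_star_reduce:
  fixes g :: "'v::finite \<Rightarrow> real"
  assumes sym: "\<And>x y. c x y = c y x" and c: "\<And>x y. 0 \<le> c x y" and z: "z \<in> W" and l: "0 \<le> l"
    and walk: "\<And>g. (\<Sum>x\<in>W. g x) = 0 \<Longrightarrow> l * (\<Sum>x\<in>W. (g x)\<^sup>2) \<le> walk_form c W g"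
    and g: "(\<Sum>x\<in>W - {z}. g x) = 0"
  shows "l * (\<Sum>x\<in>W - {z}. (g x)\<^sup>2) \<le> walk_form (star_reduce c W z) (W - {z}) g"
proof -
  obtain h where h: "walk_form c W (\<lambda>x. if x = z then h else g x) = walk_form (star_reduce c W z) (W - {z}) g"
    by (rule walk_form_star_reduce[OF sym c z])
  define n where "n = real (card W)"
  have n: "n \<ge> 1" using z unfolding n_def by (simp add: Suc_le_eq card_gt_0_iff) blast
  define k where "k x = (if x = z then h else g x) - h / n" for x
  have rem: "(\<Sum>x\<in>W. f x) = f z + (\<Sum>x\<in>W - {z}. f x)" for f :: "'v \<Rightarrow> real"
    using z by (simp add: sum.remove)
  have m: "(\<Sum>x\<in>W. if x = z then h else g x) = h"
    by (subst rem) (simp add: g cong: sum.cong_simp)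
  have "(\<Sum>x\<in>W. k x) = 0"
    using n z by (auto simp: k_def sum_subtractf m n_def)
  then have "l * (\<Sum>x\<in>W. (k x)\<^sup>2) \<le> walk_form c W k" by (rule walk)
  also have "walk_form c W k = walk_form (star_reduce c W z) (W - {z}) g"
    unfolding k_def walk_form_shift h ..
  finally have 1: "l * (\<Sum>x\<in>W. (k x)\<^sup>2) \<le> walk_form (star_reduce c W z) (W - {z}) g" .
  have "(\<Sum>x\<in>W. (k x)\<^sup>2) = (\<Sum>x\<in>W. (if x = z then h else g x)\<^sup>2 - 2 * (h / n) * (if x = z then h else g x) + (h / n)\<^sup>2)"
    by (intro sum.cong refl) (simp add: k_def power2_diff)
  also have "\<dots> = (\<Sum>x\<in>W. (if x = z then h else g x)\<^sup>2) - 2 * (h / n) * h + n * (h / n)\<^sup>2"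
    unfolding sum.distrib sum_subtractf sum_distrib_left[symmetric] m by (simp add: n_def)
  also have "(\<Sum>x\<in>W. (if x = z then h else g x)\<^sup>2) = h\<^sup>2 + (\<Sum>x\<in>W - {z}. (g x)\<^sup>2)"
    by (subst rem) (simp cong: sum.cong_simp)
  finally have "(\<Sum>x\<in>W. (k x)\<^sup>2) = (\<Sum>x\<in>W - {z}. (g x)\<^sup>2) + h\<^sup>2 * (1 - 1 / n)"
    using n by (simp add: power2_eq_square field_simps)
  moreover have "0 \<le> h\<^sup>2 * (1 - 1 / n)" using n by simp
  ultimately have "(\<Sum>x\<in>W - {z}. (g x)\<^sup>2) \<le> (\<Sum>x\<in>W. (k x)\<^sup>2)" by linarith
  then have "l * (\<Sum>x\<in>W - {z}. (g x)\<^sup>2) \<le> l * (\<Sum>x\<in>W. (k x)\<^sup>2)"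
    using l by (rule mult_left_mono)
  with 1 show ?thesis by linarith
qed

text \<open>Here \<open>l\<close> is a lower bound for the walk gap rather than the gap itself: the
  gap may grow when a vertex is removed, whereas the induction has to carry one fixed bound.\<close>

theorem exclusion_gap:
  fixes f :: "'v::finite set \<Rightarrow> real"
  assumes "\<And>x y. c x y = c y x" "\<And>x y. 0 \<le> c x y" "0 \<le> l"
    and "\<And>g. (\<Sum>x\<in>W. g x) = 0 \<Longrightarrow> l * (\<Sum>x\<in>W. (g x)\<^sup>2) \<le> walk_form c W g"
    and "(\<Sum>A\<in>confs W k. f A) = 0"
  shows "l * (\<Sum>A\<in>confs W k. (f A)\<^sup>2) \<le> excl_form c W k f"
  using assms
proof (induction "card W" arbitrary: W c f k rule: less_induct)
  case less
  note sym = less.prems(1) and c = less.prems(2) and l = less.prems(3) and walk = less.prems(4)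
    and f = less.prems(5)
  show ?case
  proof (cases "1 \<le> k \<and> k < card W")
    case False
    then consider "k = 0" | "k = card W" | "card W < k" by linarith
    \<comment> \<open>There is at most one configuration, and on it a function of sum zero
      vanishes.\<close>
    then have "\<exists>B. confs W k \<subseteq> {B}"
    proof cases
      case 1
      then have "confs W k \<subseteq> {{}}" by (auto simp: confs_def card_eq_0_iff)
      then show ?thesis by blast
    next
      case 2
      then have "confs W k \<subseteq> {W}" using card_subset_eq[of W] by (auto simp: confs_def)
      then show ?thesis by blast
    next
      case 3
      have "card A \<noteq> k" if "A \<subseteq> W" for A using card_mono[OF finite that] 3 by simp
      then have "confs W k = {}" by (auto simp: confs_def)
      then show ?thesis by blast
    qed
    then obtain B where "confs W k = {} \<or> confs W k = {B}" by blast
    then have "(\<Sum>A\<in>confs W k. (f A)\<^sup>2) = 0" using f by auto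
    then show ?thesis using excl_form_nonneg[of c W k f] c by simp
  next
    case True
    then have k: "1 \<le> k" "k < card W" by auto
    define N where "N = real ((card W - 2) choose (k - 1))"
    have N: "N > 0" using k by (simp add: N_def)
    define a where "a x = (\<Sum>A\<in>{A \<in> confs W k. x \<in> A}. f A) / N" for x
    define f2 where "f2 A = f A - sum a A" for A
    have card_k: "(\<Sum>x\<in>A. 1) = real k" if "A \<in> confs W k" for A
      using that by (simp add: confs_def)
    have "(\<Sum>x\<in>W. N * a x) = (\<Sum>A\<in>confs W k. (\<Sum>x\<in>A. 1) * f A)"
      using sum_marginals[of W "\<lambda>_. 1" f k] N by (simp add: a_def)
    also have "\<dots> = (\<Sum>A\<in>confs W k. real k * f A)"
      by (intro sum.cong refl) (simp only: card_k)
    also have "\<dots> = 0"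
      using f by (simp flip: sum_distrib_left)
    finally have a0: "(\<Sum>x\<in>W. a x) = 0" using N by (simp flip: sum_distrib_left)
    have marg: "(\<Sum>A\<in>{A \<in> confs W k. x \<in> A}. f2 A) = 0" if "x \<in> W" for x
      using marginal_lift[OF _ that k(1) a0] N by (simp add: f2_def sum_subtractf a_def N_def)
    have "real k * (\<Sum>A\<in>confs W k. f2 A) = (\<Sum>A\<in>confs W k. (\<Sum>x\<in>A. 1) * f2 A)"
      unfolding sum_distrib_left by (intro sum.cong refl) (simp only: card_k)
    also have "\<dots> = 0"
      using sum_marginals[of W "\<lambda>_. 1" f2 k] marg by simp
    finally have f20: "(\<Sum>A\<in>confs W k. f2 A) = 0" using k by simp
    have "W \<noteq> {}" using k by auto
    then obtain z where z: "z \<in> W" by blast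
    let ?c = "star_reduce c W z"
    have lt: "card (W - {z}) < card W" by (rule card_Diff1_less[OF finite z])
    have c': "0 \<le> ?c x y" for x y
      unfolding star_reduce_def by (intro add_nonneg_nonneg divide_nonneg_nonneg mult_nonneg_nonneg sum_nonneg c)
    have sym': "?c x y = ?c y x" for x y
      unfolding star_reduce_def sym[of x y] by (simp only: mult.commute)
    have walk': "l * (\<Sum>x\<in>W - {z}. (g x)\<^sup>2) \<le> walk_form ?c (W - {z}) g"
      if "(\<Sum>x\<in>W - {z}. g x) = 0" for g
      by (rule walk_gap_star_reduce[OF sym c z l _ that]) (rule walk)
    have IH: "l * (\<Sum>A\<in>confs (W - {z}) j. (h A)\<^sup>2) \<le> excl_form ?c (W - {z}) j h"
      if "(\<Sum>A\<in>confs (W - {z}) j. h A) = 0" for h j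
      by (rule less.hyps[OF lt sym' c' l _ that]) (rule walk')
    note rm = sum_confs_remove[OF z k(1) finite]
    have 1: "(\<Sum>A\<in>confs (W - {z}) (k - 1). f2 (insert z A)) = 0"
      using rm(2)[of f2] marg[OF z] by simp
    have 0: "(\<Sum>A\<in>confs (W - {z}) k. f2 A) = 0"
      using rm(1)[of f2] 1 f20 by simp
    have "l * (\<Sum>A\<in>confs W k. (f2 A)\<^sup>2)
        = l * (\<Sum>A\<in>confs (W - {z}) k. (f2 A)\<^sup>2) + l * (\<Sum>A\<in>confs (W - {z}) (k - 1). (f2 (insert z A))\<^sup>2)"
      unfolding rm(1)[of "\<lambda>A. (f2 A)\<^sup>2"] by (simp add: distrib_left)
    also have "\<dots> \<le> excl_form ?c (W - {z}) k f2 + excl_form ?c (W - {z}) (k - 1) (\<lambda>A. f2 (insert z A))"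
      by (rule add_mono[OF IH[OF 0] IH[OF 1]])
    also have "\<dots> \<le> excl_form c W k f2"
      by (rule excl_form_star_reduce[OF sym c z k(1)])
    finally have E2: "l * (\<Sum>A\<in>confs W k. (f2 A)\<^sup>2) \<le> excl_form c W k f2" .
    have "l * (\<Sum>A\<in>confs W k. (sum a A)\<^sup>2) = N * (l * (\<Sum>x\<in>W. (a x)\<^sup>2))"
      using k a0 by (simp add: norm_lift N_def)
    also have "\<dots> \<le> N * walk_form c W a"
      using walk[OF a0] N by simp
    also have "\<dots> = excl_form c W k (sum a)"
      using k by (simp add: excl_form_lift N_def)
    finally have E1: "l * (\<Sum>A\<in>confs W k. (sum a A)\<^sup>2) \<le> excl_form c W k (sum a)" .
    have "sum a A + f2 A = f A" for A by (simp add: f2_def)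
    then have "(\<Sum>A\<in>confs W k. (f A)\<^sup>2) = (\<Sum>A\<in>confs W k. (sum a A)\<^sup>2) + (\<Sum>A\<in>confs W k. (f2 A)\<^sup>2)"
      and "excl_form c W k f = excl_form c W k (sum a) + excl_form c W k f2"
      using norm_orthogonal[OF finite marg, of a] excl_form_orthogonal[OF finite marg, of c a] by simp_all
    then show ?thesis
      using E1 E2 by (simp add: distrib_left)
  qed
qed

section \<open>The graph Laplacian\<close>

text \<open>Eigenvectors of distinct eigenvalues are orthogonal, hence independent. The real
  formulation serves both the Laplacian and the Hamiltonian, whose complex space is Euclidean over
  the reals.\<close>

lemma finite_selfadjoint_eigenvalues:
  fixes f :: "'a::euclidean_space \<Rightarrow> 'a"
  assumes adj: "\<And>x y. f x \<bullet> y = x \<bullet> f y"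
  shows "finite {e. \<exists>x. x \<noteq> 0 \<and> f x = e *\<^sub>R x}"
proof -
  let ?E = "{e. \<exists>x. x \<noteq> 0 \<and> f x = e *\<^sub>R x}"
  define v where "v e = (SOME x. x \<noteq> 0 \<and> f x = e *\<^sub>R x)" for e
  have v: "v e \<noteq> 0 \<and> f (v e) = e *\<^sub>R v e" if "e \<in> ?E" for e
    unfolding v_def by (rule someI_ex[where P = "\<lambda>x. x \<noteq> 0 \<and> f x = e *\<^sub>R x"]) (use that in simp)
  have inj: "inj_on v ?E"
  proof (rule inj_onI)
    fix a b assume "a \<in> ?E" "b \<in> ?E" "v a = v b"
    then show "a = b" using v[of a] v[of b] by (metis scaleR_right_imp_eq)
  qed
  have "pairwise orthogonal (v ` ?E)"
    unfolding pairwise_image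
  proof (intro pairwiseI impI)
    fix a b assume ab: "a \<in> ?E" "b \<in> ?E" "a \<noteq> b"
    have "a * (v a \<bullet> v b) = b * (v a \<bullet> v b)"
      using adj[of "v a" "v b"] v[OF ab(1)] v[OF ab(2)] by simp
    then show "orthogonal (v a) (v b)" using ab by (simp add: orthogonal_def)
  qed
  moreover have "0 \<notin> v ` ?E" using v by force
  ultimately have "independent (v ` ?E)" by (rule pairwise_orthogonal_independent)
  then have "finite (v ` ?E)" by (rule independent_imp_finite)
  then show ?thesis using inj by (rule finite_imageD)
qed

text \<open>For small \<open>t\<close> of the right sign a nonzero linear term wins;
  \<open>D\<close> exceeds the size of \<open>K\<close>, so \<open>- a / D\<close> is small enough.
  It turns minimality into a vanishing first variation.\<close>

lemma nonneg_quadratic_imp_linear_zero: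
  fixes a K :: real
  assumes "\<And>t. 0 \<le> 2 * t * a + t\<^sup>2 * K"
  shows "a = 0"
proof (rule ccontr)
  assume "a \<noteq> 0"
  define D where "D = \<bar>K\<bar> + 1"
  define t where "t = - a / D"
  have D: "D > 0" by (simp add: D_def)
  have "t\<^sup>2 * K \<le> t\<^sup>2 * D" by (intro mult_left_mono) (auto simp: D_def)
  also have "\<dots> = - t * a" using D by (simp add: t_def power2_eq_square)
  finally have "2 * t * a + t\<^sup>2 * K \<le> t * a" by linarith
  moreover have "t * a = - (a\<^sup>2 / D)" by (simp add: t_def power2_eq_square)
  moreover have "a\<^sup>2 / D > 0" using \<open>a \<noteq> 0\<close> D by (intro divide_pos_pos) auto
  ultimately show False using assms[of t] by linarith
qed

lemma laplacian_nth:
  "(laplacian adj *v g) $ u = (\<Sum>w\<in>UNIV. of_bool (adj u w) * (g $ u - g $ w))"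
  for g :: "real^'v::finite"
proof -
  have "(laplacian adj *v g) $ u
    = (\<Sum>w\<in>UNIV. (if u = w then real (card {w. adj u w}) else 0) * g $ w - of_bool (adj u w) * g $ w)"
    unfolding matrix_vector_mult_def laplacian_def degree_matrix_def adjacency_matrix_def
    by (simp add: left_diff_distrib of_bool_def)
  also have "\<dots> = real (card {w. adj u w}) * g $ u - (\<Sum>w\<in>UNIV. of_bool (adj u w) * g $ w)"
    by (simp add: sum_subtractf if_distrib[of "\<lambda>t. t * _"] cong: if_cong)
  also have "real (card {w. adj u w}) = (\<Sum>w\<in>UNIV. of_bool (adj u w))"
    by simp
  finally show ?thesis by (simp add: right_diff_distrib sum_subtractf sum_distrib_right)
qed

lemma walk_form_laplacian:
  fixes g :: "real^'v::finite"
  assumes "symp adj"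
  shows "g \<bullet> (laplacian adj *v g) = walk_form (\<lambda>x y. of_bool (adj x y)) UNIV (\<lambda>x. g $ x)"
proof -
  let ?c = "\<lambda>x y. of_bool (adj x y) :: real"
  have sym: "?c x y = ?c y x" for x y using assms by (auto simp: symp_def)
  have "(\<Sum>u\<in>UNIV. \<Sum>w\<in>UNIV. ?c u w * (g $ u - g $ w) * g $ w) = (\<Sum>w\<in>UNIV. \<Sum>u\<in>UNIV. ?c u w * (g $ u - g $ w) * g $ w)"
    by (rule sum.swap)
  also have "\<dots> = - (\<Sum>w\<in>UNIV. \<Sum>u\<in>UNIV. ?c w u * (g $ w - g $ u) * g $ w)"
    unfolding sum_negf[symmetric] by (intro sum.cong refl) (simp add: sym algebra_simps)
  finally have 1: "(\<Sum>u\<in>UNIV. \<Sum>w\<in>UNIV. ?c u w * (g $ u - g $ w) * g $ w)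
     = - (\<Sum>w\<in>UNIV. \<Sum>u\<in>UNIV. ?c w u * (g $ w - g $ u) * g $ w)" .
  have "(\<Sum>u\<in>UNIV. \<Sum>w\<in>UNIV. ?c u w * (g $ u - g $ w)\<^sup>2)
    = (\<Sum>u\<in>UNIV. \<Sum>w\<in>UNIV. ?c u w * (g $ u - g $ w) * g $ u) - (\<Sum>u\<in>UNIV. \<Sum>w\<in>UNIV. ?c u w * (g $ u - g $ w) * g $ w)"
    unfolding sum_subtractf[symmetric] by (intro sum.cong refl) (simp add: power2_eq_square algebra_simps)
  also have "\<dots> = 2 * (\<Sum>u\<in>UNIV. \<Sum>w\<in>UNIV. ?c u w * (g $ u - g $ w) * g $ u)"
    unfolding 1 by simp
  also have "(\<Sum>u\<in>UNIV. \<Sum>w\<in>UNIV. ?c u w * (g $ u - g $ w) * g $ u) = g \<bullet> (laplacian adj *v g)"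
    unfolding inner_vec_def laplacian_nth inner_real_def sum_distrib_left
    by (intro sum.cong refl) (simp only: mult_ac)
  finally show ?thesis by (simp add: walk_form_def)
qed

lemma laplacian_selfadjoint:
  fixes g h :: "real^'v::finite"
  assumes "symp adj"
  shows "(laplacian adj *v g) \<bullet> h = g \<bullet> (laplacian adj *v h)"
proof -
  have "transpose (laplacian adj) = laplacian adj"
    using assms by (auto simp: laplacian_def degree_matrix_def adjacency_matrix_def vec_eq_iff
        Finite_Cartesian_Product.transpose_def symp_def)
  then show ?thesis by (metis dot_lmul_matrix vector_transpose_matrix)
qed

lemma sum_laplacian:
  fixes g :: "real^'v::finite"
  assumes "symp adj"
  shows "(\<Sum>x\<in>UNIV. (laplacian adj *v g) $ x) = 0"
proof -
  have "laplacian adj *v 1 = 0" by (simp add: vec_eq_iff laplacian_nth)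
  then have "(laplacian adj *v g) \<bullet> 1 = 0" by (simp add: laplacian_selfadjoint[OF assms])
  then show ?thesis by (simp add: inner_vec_def)
qed

lemma connected_graph_const:
  assumes "connected_graph adj" "\<And>x y. adj x y \<Longrightarrow> g x = g y"
  shows "g x = g y"
proof -
  have "adj\<^sup>*\<^sup>* x y" using assms(1) by (auto simp: connected_graph_def)
  then show ?thesis by (induction) (auto simp: assms(2))
qed

text \<open>The quadratic form attains its minimum on the unit sphere of the mean zero vectors, and
  the minimiser is an eigenvector. This links the definition of \<open>lambda2\<close> as a least
  positive eigenvalue to the Rayleigh bound used for the walk.\<close>

lemma lambda2_laplacian:
  fixes adj :: "'v::finite \<Rightarrow> 'v \<Rightarrow> bool"
  assumes "symp adj" and conn: "connected_graph adj" and card: "2 \<le> CARD('v)"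
  defines "l \<equiv> lambda2 (laplacian adj)"
  shows "0 < l"
    and "\<exists>g :: real^'v. g \<noteq> 0 \<and> laplacian adj *v g = l *\<^sub>R g \<and> (\<Sum>x\<in>UNIV. g $ x) = 0"
    and "\<And>g. (\<Sum>x\<in>UNIV. g x) = 0 \<Longrightarrow>
      l * (\<Sum>x\<in>UNIV. (g x)\<^sup>2) \<le> walk_form (\<lambda>x y. of_bool (adj x y)) UNIV g"
proof -
  let ?L = "laplacian adj"
  let ?q = "\<lambda>g :: real^'v. g \<bullet> (?L *v g)"
  define Z where "Z = {g :: real^'v. (\<Sum>x\<in>UNIV. g $ x) = 0}"
  have subZ: "subspace Z"
    by (auto simp: subspace_def Z_def sum.distrib simp flip: sum_distrib_left)
  let ?S = "sphere 0 1 \<inter> Z"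
  have "compact ?S"
    by (intro compact_Int_closed compact_sphere closed_subspace subZ)
  moreover have "?S \<noteq> {}"
  proof -
    obtain a b :: 'v where ab: "a \<noteq> b"
      using card card_le_Suc0_iff_eq[of "UNIV :: 'v set"] by auto
    define d :: "real^'v" where "d = axis a 1 - axis b 1"
    have "d \<in> Z" by (simp add: d_def Z_def sum_subtractf axis_def)
    moreover have "d $ a = 1" using ab by (simp add: d_def axis_def)
    then have "d \<noteq> 0" by auto
    ultimately have "d /\<^sub>R norm d \<in> ?S" by (simp add: subspace_scale[OF subZ])
    then show ?thesis by blast
  qed
  moreover have "continuous_on ?S ?q"
    by (intro continuous_intros linear_continuous_on_compose matrix_vector_mul_linear)
  ultimately obtain g0 where g0: "g0 \<in> ?S" "\<And>g. g \<in> ?S \<Longrightarrow> ?q g0 \<le> ?q g"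
    using continuous_attains_inf[of ?S ?q] by blast
  define m where "m = ?q g0"
  have g0Z: "g0 \<in> Z" and g01: "g0 \<bullet> g0 = 1" using g0(1) by (auto simp: norm_eq_1)
  have qm: "m * (g \<bullet> g) \<le> ?q g" if "g \<in> Z" for g
  proof (cases "g = 0")
    case False
    then have "g /\<^sub>R norm g \<in> ?S" using that by (simp add: subspace_scale[OF subZ])
    then have "m \<le> ?q (g /\<^sub>R norm g)" unfolding m_def by (rule g0(2))
    also have "\<dots> = ?q g / (g \<bullet> g)"
      using False by (simp add: matrix_vector_mult_scaleR dot_square_norm power2_eq_square divide_inverse)
    finally show ?thesis using False by (simp add: pos_le_divide_eq)
  qed simp
  \<comment> \<open>The residual has sum zero itself, so it is a permitted direction of variation,
    and the first variation along it is a multiple of its squared norm.\<close>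
  define r where "r = ?L *v g0 - m *\<^sub>R g0"
  have rZ: "r \<in> Z"
    using g0Z sum_laplacian[OF assms(1), of g0]
    by (simp add: r_def Z_def sum_subtractf flip: sum_distrib_left)
  have "r \<bullet> r = 0"
  proof (rule nonneg_quadratic_imp_linear_zero)
    fix t
    have "g0 + t *\<^sub>R r \<in> Z" by (intro subspace_add subspace_scale subZ g0Z rZ)
    then have "0 \<le> ?q (g0 + t *\<^sub>R r) - m * ((g0 + t *\<^sub>R r) \<bullet> (g0 + t *\<^sub>R r))" using qm by simp
    also have "?q (g0 + t *\<^sub>R r) = m + 2 * t * (r \<bullet> (?L *v g0)) + t\<^sup>2 * ?q r"
      using laplacian_selfadjoint[OF assms(1), of g0 r]
      by (simp add: m_def matrix_vector_right_distrib matrix_vector_mult_scaleR inner_add_left inner_add_right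
          power2_eq_square inner_commute algebra_simps)
    also have "(g0 + t *\<^sub>R r) \<bullet> (g0 + t *\<^sub>R r) = 1 + 2 * t * (r \<bullet> g0) + t\<^sup>2 * (r \<bullet> r)"
      by (simp add: g01 inner_add_left inner_add_right power2_eq_square inner_commute algebra_simps)
    also have "m + 2 * t * (r \<bullet> (?L *v g0)) + t\<^sup>2 * ?q r - m * (1 + 2 * t * (r \<bullet> g0) + t\<^sup>2 * (r \<bullet> r))
      = 2 * t * (r \<bullet> (?L *v g0) - m * (r \<bullet> g0)) + t\<^sup>2 * (?q r - m * (r \<bullet> r))"
      by (simp add: algebra_simps)
    also have "r \<bullet> (?L *v g0) - m * (r \<bullet> g0) = r \<bullet> r"
      by (simp add: r_def inner_diff_right)
    finally show "0 \<le> 2 * t * (r \<bullet> r) + t\<^sup>2 * (?q r - m * (r \<bullet> r))" .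
  qed
  then have eig: "?L *v g0 = m *\<^sub>R g0" by (simp add: r_def)
  have g00: "g0 \<noteq> 0" using g01 by auto
  have c0: "0 \<le> of_bool (adj x y) * (g0 $ x - g0 $ y)\<^sup>2" for x y by simp
  have m0: "0 \<le> m"
    unfolding m_def walk_form_laplacian[OF assms(1)] walk_form_def by (intro divide_nonneg_pos sum_nonneg c0) auto
  \<comment> \<open>A vanishing form makes \<open>g0\<close> constant along edges, hence constant by
    connectedness, and sum zero then contradicts norm 1.\<close>
  have "m \<noteq> 0"
  proof
    assume "m = 0"
    then have "(\<Sum>x\<in>UNIV. \<Sum>y\<in>UNIV. of_bool (adj x y) * (g0 $ x - g0 $ y)\<^sup>2) = 0"
      unfolding m_def walk_form_laplacian[OF assms(1)] walk_form_def by simp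
    then have le: "(\<Sum>x\<in>UNIV. \<Sum>y\<in>UNIV. of_bool (adj x y) * (g0 $ x - g0 $ y)\<^sup>2) \<le> 0" by simp
    have "g0 $ x = g0 $ y" if "adj x y" for x y
    proof -
      have "(g0 $ x - g0 $ y)\<^sup>2 \<le> of_bool (adj x y) * (g0 $ x - g0 $ y)\<^sup>2" using that by simp
      also have "\<dots> \<le> (\<Sum>y\<in>UNIV. of_bool (adj x y) * (g0 $ x - g0 $ y)\<^sup>2)"
        by (rule member_le_sum) (auto simp: c0)
      also have "\<dots> \<le> (\<Sum>x\<in>UNIV. \<Sum>y\<in>UNIV. of_bool (adj x y) * (g0 $ x - g0 $ y)\<^sup>2)"
        by (rule member_le_sum) (auto intro!: sum_nonneg c0 simp del: sum_of_bool_mult_eq)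
      also note le
      finally show ?thesis by simp
    qed
    then have const: "g0 $ x = g0 $ y" for x y by (rule connected_graph_const[OF conn])
    have "(\<Sum>x\<in>UNIV. g0 $ x) = (\<Sum>x::'v\<in>UNIV. g0 $ undefined)" by (intro sum.cong refl const)
    then have "g0 $ undefined = 0" using g0Z by (simp add: Z_def)
    then have "g0 = 0" using const by (metis vec_eq_iff zero_index)
    then show False using g00 by simp
  qed
  with m0 have mpos: "0 < m" by simp
  have eq: "eigenvalue_on ?L UNIV e \<longleftrightarrow> (\<exists>x. x \<noteq> 0 \<and> ?L *v x = e *\<^sub>R x)" for e
    by (auto simp: eigenvalue_on_def eigenspace_on_def scalar_mult_eq_scaleR)
  have "l = m"
    unfolding l_def lambda2_def
  proof (rule Min_eqI)
    have "finite {e. eigenvalue_on ?L UNIV e}"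
      unfolding eq by (rule finite_selfadjoint_eigenvalues) (rule laplacian_selfadjoint[OF assms(1)])
    then show "finite {e. 0 < e \<and> eigenvalue_on ?L UNIV e}" by (rule rev_finite_subset) auto
    show "m \<in> {e. 0 < e \<and> eigenvalue_on ?L UNIV e}" using mpos eig g00 eq by auto
    fix e assume "e \<in> {e. 0 < e \<and> eigenvalue_on ?L UNIV e}"
    then obtain x where x: "0 < e" "x \<noteq> 0" "?L *v x = e *\<^sub>R x" using eq by auto
    \<comment> \<open>Images under the Laplacian have sum zero, so an eigenvector with
      \<open>e > 0\<close> lies in \<open>Z\<close>, where the Rayleigh bound holds.\<close>
    have "e * (\<Sum>i\<in>UNIV. x $ i) = 0"
      using sum_laplacian[OF assms(1), of x] by (simp add: x sum_distrib_left)
    then have "x \<in> Z" using x by (simp add: Z_def)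
    then have "m * (x \<bullet> x) \<le> e * (x \<bullet> x)" using qm[of x] x by simp
    then show "m \<le> e" using x by simp
  qed
  then show "0 < l" using mpos by simp
  show "\<exists>g :: real^'v. g \<noteq> 0 \<and> laplacian adj *v g = l *\<^sub>R g \<and> (\<Sum>x\<in>UNIV. g $ x) = 0"
    using eig g00 g0Z \<open>l = m\<close> by (auto simp: Z_def)
  fix g :: "'v \<Rightarrow> real" assume g: "(\<Sum>x\<in>UNIV. g x) = 0"
  define v where "v = (\<chi> x. g x)"
  have "v \<in> Z" using g by (simp add: Z_def v_def)
  then show "l * (\<Sum>x\<in>UNIV. (g x)\<^sup>2) \<le> walk_form (\<lambda>x y. of_bool (adj x y)) UNIV g"
    using qm[of v] \<open>l = m\<close> unfolding walk_form_laplacian[OF assms(1)]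
    by (simp add: v_def inner_vec_def power2_eq_square walk_form_def)
qed

section \<open>Removing the Jordan-Wigner signs\<close>

definition cell :: "'v \<Rightarrow> 'v mode set" where "cell R = {R} \<times> UNIV"

definition ord_sign :: "'v::finite mode \<Rightarrow> 'v mode \<Rightarrow> complex" where
  "ord_sign a b = (if to_nat b < to_nat a then -1 else 1)"

lemma mem_cell [simp]: "b \<in> cell R \<longleftrightarrow> fst b = R"
  by (cases b) (auto simp: cell_def)

lemma ord_sign_sq: "ord_sign a b * ord_sign a b = 1"
  by (simp add: ord_sign_def)

lemma ord_sign_swap: "a \<noteq> b \<Longrightarrow> ord_sign b a = - ord_sign a b"
  using to_nat_split[of a b] by (auto simp: ord_sign_def not_less le_less)

lemma jw_sign_insert': "b \<notin> S \<Longrightarrow> jw_sign a (insert b S) = ord_sign a b * jw_sign a S"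
  by (simp add: jw_sign_insert ord_sign_def)

lemma jw_sign_prod: "jw_sign a S = (\<Prod>b\<in>S. ord_sign a b)"
  for S :: "'v::finite mode set"
proof -
  have "finite S" by simp
  then show ?thesis
    by (induction S) (simp_all add: jw_sign_insert' jw_sign_def[of a "{}"])
qed

lemma cre_mult_vec: "(cre a *v x) $ T = (if a \<in> T then jw_sign a (T - {a}) * x $ (T - {a}) else 0)"
proof -
  have "(cre a *v x) $ T = (\<Sum>S\<in>UNIV. if S = T - {a} then (if a \<in> T then jw_sign a (T - {a}) * x $ (T - {a}) else 0) else 0)"
    unfolding matrix_vector_mult_def vec_lambda_beta
    by (rule sum.cong[OF refl]) (auto simp: cre_nth insert_absorb)
  then show ?thesis by simp
qed

lemma ann_mult_vec: "(ann a *v x) $ T = (if a \<notin> T then jw_sign a T * x $ (insert a T) else 0)"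
proof -
  have "(ann a *v x) $ T = (\<Sum>S\<in>UNIV. if S = insert a T then (if a \<notin> T then jw_sign a T * x $ (insert a T) else 0) else 0)"
    unfolding matrix_vector_mult_def vec_lambda_beta
    by (rule sum.cong[OF refl]) (auto simp: ann_nth)
  then show ?thesis by simp
qed

lemma dagger_dagger [simp]: "dagger (dagger A) = A"
  by (simp add: dagger_def vec_eq_iff)

lemma dagger_mult: "dagger (A ** B) = dagger B ** dagger A"
  by (simp add: dagger_def vec_eq_iff matrix_matrix_mult_def mult.commute)

lemma dagger_add: "dagger (A + B) = dagger A + dagger B"
  by (simp add: dagger_def vec_eq_iff)

lemma dagger_diff: "dagger (A - B) = dagger A - dagger B"
  by (simp add: dagger_def vec_eq_iff)

lemma dagger_scaleR: "dagger (r *\<^sub>R A) = r *\<^sub>R dagger A"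
  by (simp add: dagger_def vec_eq_iff)

lemma dagger_sum: "dagger (\<Sum>i\<in>I. A i) = (\<Sum>i\<in>I. dagger (A i))"
  by (simp add: dagger_def vec_eq_iff sum_component)

lemma dagger_mat: "dagger (mat 1) = mat 1"
  by (simp add: dagger_def vec_eq_iff mat_def)

lemma dagger_diag_op: "(\<And>S. cnj (f S) = f S) \<Longrightarrow> dagger (diag_op f) = diag_op f"
  by (auto simp: dagger_def vec_eq_iff diag_op_def)

text \<open>The real inner product is the real part of the Hermitian one. A matrix equal to its
  \<open>dagger\<close> is therefore selfadjoint in the real sense too.\<close>

lemma inner_dagger: "(A *v x) \<bullet> y = x \<bullet> (dagger A *v y)"
  for A :: "complex^'n^'m"
proof -
  have ip: "a \<bullet> b = Re (cnj a * b)" for a b :: complex by (simp add: inner_complex_def)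
  have "(A *v x) \<bullet> y = (\<Sum>i\<in>UNIV. \<Sum>j\<in>UNIV. Re (cnj (A $ i $ j * x $ j) * y $ i))"
    unfolding inner_vec_def matrix_vector_mult_def vec_lambda_beta ip cnj_sum sum_distrib_right Re_sum ..
  also have "\<dots> = (\<Sum>j\<in>UNIV. \<Sum>i\<in>UNIV. Re (cnj (A $ i $ j * x $ j) * y $ i))"
    by (rule sum.swap)
  also have "\<dots> = (\<Sum>j\<in>UNIV. \<Sum>i\<in>UNIV. Re (cnj (x $ j) * (cnj (A $ i $ j) * y $ i)))"
    by (simp only: complex_cnj_mult mult_ac)
  also have "\<dots> = x \<bullet> (dagger A *v y)"
    unfolding inner_vec_def matrix_vector_mult_def vec_lambda_beta ip sum_distrib_left Re_sum dagger_def ..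
  finally show ?thesis .
qed

text \<open>The sign that \<open>qdag R\<close> picks up within its own cell, where the modes are
  created in the order 4, 3, 2, 1.\<close>

definition cell_sign :: "'v::finite \<Rightarrow> complex" where
  "cell_sign R = ord_sign (R, 3) (R, 4) * (ord_sign (R, 2) (R, 3) * ord_sign (R, 2) (R, 4)) *
     (ord_sign (R, 1) (R, 2) * ord_sign (R, 1) (R, 3) * ord_sign (R, 1) (R, 4))"

definition cross_sign :: "'v::finite \<Rightarrow> 'v mode \<Rightarrow> complex" where
  "cross_sign R b = (\<Prod>m\<in>UNIV. ord_sign (R, m) b)"

text \<open>The matrix element of \<open>qdag R\<close> on a set \<open>S\<close> in which
  \<open>R\<close> is empty, and hence also that of \<open>qop R\<close> back to
  \<open>S\<close>.\<close>

definition quartet_sign :: "'v::finite \<Rightarrow> 'v mode set \<Rightarrow> complex" where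
  "quartet_sign R S = cell_sign R * (\<Prod>b\<in>S. cross_sign R b)"

lemma distinct_four: "(1::4) \<noteq> 2" "(1::4) \<noteq> 3" "(1::4) \<noteq> 4" "(2::4) \<noteq> 3" "(2::4) \<noteq> 4" "(3::4) \<noteq> 4"
  by simp_all

lemma cell_four: "cell R = {(R, 1), (R, 2), (R, 3), (R, 4)}"
  unfolding cell_def UNIV_4 by auto

lemma quartet_sign_jw:
  assumes "S \<inter> cell R = {}"
  shows "jw_sign (R, 1) (insert (R, 2) (insert (R, 3) (insert (R, 4) S))) *
    (jw_sign (R, 2) (insert (R, 3) (insert (R, 4) S)) *
     (jw_sign (R, 3) (insert (R, 4) S) * jw_sign (R, 4) S)) = quartet_sign R S"
proof -
  have n: "(R, m) \<notin> S" for m using assms by auto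
  have cross: "cross_sign R b = ord_sign (R, 1) b * (ord_sign (R, 2) b * (ord_sign (R, 3) b * ord_sign (R, 4) b))" for b
    unfolding cross_sign_def UNIV_4 using distinct_four by simp
  have "(\<Prod>b\<in>S. cross_sign R b) = jw_sign (R, 1) S * (jw_sign (R, 2) S * (jw_sign (R, 3) S * jw_sign (R, 4) S))"
    unfolding cross jw_sign_prod prod.distrib ..
  moreover have "jw_sign (R, 1) (insert (R, 2) (insert (R, 3) (insert (R, 4) S)))
      = ord_sign (R, 1) (R, 2) * (ord_sign (R, 1) (R, 3) * (ord_sign (R, 1) (R, 4) * jw_sign (R, 1) S))"
    "jw_sign (R, 2) (insert (R, 3) (insert (R, 4) S)) = ord_sign (R, 2) (R, 3) * (ord_sign (R, 2) (R, 4) * jw_sign (R, 2) S)"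
    "jw_sign (R, 3) (insert (R, 4) S) = ord_sign (R, 3) (R, 4) * jw_sign (R, 3) S"
    using n distinct_four by (simp_all add: jw_sign_insert')
  ultimately show ?thesis
    by (simp only: quartet_sign_def cell_sign_def mult_ac)
qed

lemma qdag_mult_vec:
  "(qdag R *v x) $ T = (if cell R \<subseteq> T then quartet_sign R (T - cell R) * x $ (T - cell R) else 0)"
proof (cases "cell R \<subseteq> T")
  case True
  define S where "S = T - cell R"
  have S: "S \<inter> cell R = {}" and T: "T = insert (R, 1) (insert (R, 2) (insert (R, 3) (insert (R, 4) S)))"
    using True by (auto simp: S_def cell_four)
  have n: "(R, m) \<notin> S" for m using S by auto
  have rm: "T - {(R, 1)} = insert (R, 2) (insert (R, 3) (insert (R, 4) S))"
    "insert (R, 2) (insert (R, 3) (insert (R, 4) S)) - {(R, 2)} = insert (R, 3) (insert (R, 4) S)"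
    "insert (R, 3) (insert (R, 4) S) - {(R, 3)} = insert (R, 4) S"
    "insert (R, 4) S - {(R, 4)} = S"
    using n distinct_four by (auto simp: T)
  have "(qdag R *v x) $ T = jw_sign (R, 1) (insert (R, 2) (insert (R, 3) (insert (R, 4) S))) *
    (jw_sign (R, 2) (insert (R, 3) (insert (R, 4) S)) *
     (jw_sign (R, 3) (insert (R, 4) S) * jw_sign (R, 4) S)) * x $ S"
    unfolding qdag_def matrix_vector_mul_assoc[symmetric] cre_mult_vec[of _ _ T] rm
    by (simp add: cre_mult_vec rm T)
  then show ?thesis using True by (simp add: quartet_sign_jw[OF S] flip: S_def)
next
  case False
  then consider "(R, 1) \<notin> T" | "(R, 2) \<notin> T" | "(R, 3) \<notin> T" | "(R, 4) \<notin> T" by (auto simp: cell_four)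
  then have "(qdag R *v x) $ T = 0"
    by cases (simp_all add: qdag_def cre_mult_vec flip: matrix_vector_mul_assoc)
  then show ?thesis using False by simp
qed

lemma qop_ann: "qop R = ann (R, 4) ** ann (R, 3) ** ann (R, 2) ** ann (R, 1)"
  by (simp add: qop_def qdag_def dagger_mult ann_def matrix_mul_assoc)

lemma qop_mult_vec:
  "(qop R *v x) $ T = (if T \<inter> cell R = {} then quartet_sign R T * x $ (T \<union> cell R) else 0)"
proof (cases "T \<inter> cell R = {}")
  case True
  then have n: "(R, m) \<notin> T" for m by auto
  have "insert (R, 1) (insert (R, 2) (insert (R, 3) (insert (R, 4) T))) = T \<union> cell R"
    by (auto simp: cell_four)
  then show ?thesis
    using True n distinct_four
    by (simp add: qop_ann ann_mult_vec flip: matrix_vector_mul_assoc quartet_sign_jw[OF True])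
next
  case False
  then consider "(R, 1) \<in> T" | "(R, 2) \<in> T" | "(R, 3) \<in> T" | "(R, 4) \<in> T" by (auto simp: cell_four)
  then have "(qop R *v x) $ T = 0"
    by cases (simp_all add: qop_ann ann_mult_vec flip: matrix_vector_mul_assoc)
  then show ?thesis using False by simp
qed

lemma diag_op_mult_vec: "(diag_op f *v x) $ S = f S * x $ S"
proof -
  have "(diag_op f *v x) $ S = (\<Sum>T\<in>UNIV. if T = S then f S * x $ S else 0)"
    unfolding matrix_vector_mult_def vec_lambda_beta diag_op_def
    by (rule sum.cong[OF refl]) auto
  then show ?thesis by simp
qed

section \<open>Phases of configurations and hopping of quartets\<close>

definition full_cells :: "'v mode set \<Rightarrow> 'v set" where "full_cells S = {R. cell R \<subseteq> S}"

definition pure :: "'v mode set \<Rightarrow> 'v \<Rightarrow> bool" where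
  "pure S R \<longleftrightarrow> cell R \<subseteq> S \<or> S \<inter> cell R = {}"

definition swap_cells :: "'v \<Rightarrow> 'v \<Rightarrow> 'v mode set \<Rightarrow> 'v mode set" where
  "swap_cells R R' S = {(p, m). (Transposition.transpose R R' p, m) \<in> S}"

text \<open>The sign of the reordering that collects the creation operators of the full cells cell by cell.
  Adding a full cell \<open>R\<close> commutes it past modes in broken cells and past all other full cells; since
  the crossing sign of two cells is symmetric, each pair of full cells is counted once.\<close>

definition phase :: "'v::finite mode set \<Rightarrow> complex" where
  "phase S = (\<Prod>R\<in>full_cells S. cell_sign R * (\<Prod>b\<in>{b \<in> S. fst b \<notin> full_cells S}. cross_sign R b) *
     (\<Prod>C\<in>full_cells S. if to_nat C < to_nat R then \<Prod>m\<in>UNIV. cross_sign R (C, m) else 1))"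

lemma prod_sign_sq: "(\<And>i. i \<in> I \<Longrightarrow> f i * f i = 1) \<Longrightarrow> prod f I * prod f I = 1"
  for f :: "'i \<Rightarrow> complex"
  by (simp flip: prod.distrib)

lemma mult_sign_sq: "a * a = 1 \<Longrightarrow> b * b = 1 \<Longrightarrow> (a * b) * (a * b) = 1"
  for a b :: complex
  by (metis mult.assoc mult.commute mult_1)

lemma cross_sign_sq: "cross_sign R b * cross_sign R b = 1"
  unfolding cross_sign_def by (intro prod_sign_sq ord_sign_sq)

lemma cell_sign_sq: "cell_sign R * cell_sign R = 1"
  unfolding cell_sign_def by (intro mult_sign_sq ord_sign_sq)

lemma quartet_sign_sq: "quartet_sign R S * quartet_sign R S = 1"
  unfolding quartet_sign_def by (intro mult_sign_sq prod_sign_sq cell_sign_sq cross_sign_sq)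

lemma phase_sq: "phase S * phase S = 1"
  unfolding phase_def
  by (intro prod_sign_sq mult_sign_sq cell_sign_sq cross_sign_sq) (auto intro!: prod_sign_sq cross_sign_sq)

text \<open>Exchanging the two cells flips the sign of each of sixteen mode pairs, an even number.
  In this respect quartets behave as bosons.\<close>

lemma cross_sign_swap:
  assumes "R \<noteq> C"
  shows "(\<Prod>m\<in>UNIV. cross_sign R (C, m)) = (\<Prod>m\<in>UNIV. cross_sign C (R, m))"
proof -
  have "(\<Prod>m\<in>UNIV. cross_sign R (C, m)) = (\<Prod>m\<in>UNIV. \<Prod>k\<in>UNIV. - ord_sign (C, m) (R, k))"
    unfolding cross_sign_def using assms by (intro prod.cong refl) (metis Pair_inject ord_sign_swap)
  also have "\<dots> = (\<Prod>m\<in>UNIV. \<Prod>k\<in>UNIV. ord_sign (C, m) (R, k))"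
    by (simp add: prod_uminus)
  also have "\<dots> = (\<Prod>k\<in>UNIV. \<Prod>m\<in>UNIV. ord_sign (C, m) (R, k))" by (rule prod.swap)
  finally show ?thesis by (simp add: cross_sign_def)
qed

lemma full_cells_add: "full_cells (S \<union> cell R) = insert R (full_cells S)" if "S \<inter> cell R = {}"
  using that by (auto simp: full_cells_def)

text \<open>The factor is the matrix element of \<open>qdag R\<close> at \<open>S\<close>. Hence,
  after multiplication by \<open>phase\<close>, every creation of a quartet has amplitude 1.\<close>

lemma phase_add_cell:
  assumes S: "S \<inter> cell R = {}"
  shows "phase (S \<union> cell R) = phase S * quartet_sign R S"
proof -
  let ?F = "full_cells S" and ?B = "{b \<in> S. fst b \<notin> full_cells S}"
  let ?w = "\<lambda>P C. \<Prod>m\<in>UNIV. cross_sign P (C, m)"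
  have RF: "R \<notin> ?F" using S by (auto simp: full_cells_def cell_def)
  have B: "{b \<in> S \<union> cell R. fst b \<notin> insert R ?F} = ?B"
    using S by auto
  have Sdec: "S = ?B \<union> ?F \<times> UNIV" by (auto simp: full_cells_def cell_def)
  have "(\<Prod>b\<in>S. cross_sign R b) = (\<Prod>b\<in>?B \<union> ?F \<times> UNIV. cross_sign R b)"
    using Sdec by (rule arg_cong)
  also have "\<dots> = (\<Prod>b\<in>?B. cross_sign R b) * (\<Prod>b\<in>?F \<times> UNIV. cross_sign R b)"
    by (intro prod.union_disjoint) auto
  also have "(\<Prod>b\<in>?F \<times> UNIV. cross_sign R b) = (\<Prod>C\<in>?F. ?w R C)"
    by (simp add: prod.cartesian_product)
  \<comment> \<open>In \<open>phase\<close> each pair of full cells is charged to the later cell.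
    The crossings of \<open>R\<close> with a later cell \<open>C\<close> must reappear as a factor
    of \<open>C\<close>, which the symmetry of the crossing sign permits.\<close>
  also have "\<dots> = (\<Prod>C\<in>?F. if to_nat C < to_nat R then ?w R C else 1) * (\<Prod>C\<in>?F. if to_nat R < to_nat C then ?w C R else 1)"
    unfolding prod.distrib[symmetric]
  proof (intro prod.cong refl)
    fix C assume "C \<in> ?F"
    then have "R \<noteq> C" using RF by auto
    moreover from this have "to_nat R < to_nat C \<or> to_nat C < to_nat R" by (metis nat_neq_iff to_nat_split)
    ultimately show "?w R C = (if to_nat C < to_nat R then ?w R C else 1) * (if to_nat R < to_nat C then ?w C R else 1)"
      using cross_sign_swap[of R C] by auto
  qed
  finally have q: "quartet_sign R S = cell_sign R * (\<Prod>b\<in>?B. cross_sign R b) *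
     (\<Prod>C\<in>?F. if to_nat C < to_nat R then ?w R C else 1) * (\<Prod>C\<in>?F. if to_nat R < to_nat C then ?w C R else 1)"
    by (simp add: quartet_sign_def mult_ac)
  have "phase (S \<union> cell R) = (\<Prod>P\<in>insert R ?F. cell_sign P * (\<Prod>b\<in>?B. cross_sign P b) *
     (\<Prod>C\<in>insert R ?F. if to_nat C < to_nat P then ?w P C else 1))"
    unfolding phase_def full_cells_add[OF S] B ..
  also have "\<dots> = (cell_sign R * (\<Prod>b\<in>?B. cross_sign R b) * (\<Prod>C\<in>?F. if to_nat C < to_nat R then ?w R C else 1)) *
     (\<Prod>P\<in>?F. cell_sign P * (\<Prod>b\<in>?B. cross_sign P b) *
       ((if to_nat R < to_nat P then ?w P R else 1) * (\<Prod>C\<in>?F. if to_nat C < to_nat P then ?w P C else 1)))"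
    using RF by simp
  also have "(\<Prod>P\<in>?F. cell_sign P * (\<Prod>b\<in>?B. cross_sign P b) *
       ((if to_nat R < to_nat P then ?w P R else 1) * (\<Prod>C\<in>?F. if to_nat C < to_nat P then ?w P C else 1)))
     = (\<Prod>P\<in>?F. if to_nat R < to_nat P then ?w P R else 1) * phase S"
    unfolding phase_def prod.distrib[symmetric] by (intro prod.cong refl) (simp only: mult_ac)
  finally show ?thesis unfolding q by (simp only: mult_ac)
qed

lemma cell_subset_iff: "cell R \<subseteq> S \<longleftrightarrow> (\<forall>m. (R, m) \<in> S)"
  by (auto simp: cell_def)

lemma disjoint_cell_iff: "S \<inter> cell R = {} \<longleftrightarrow> (\<forall>m. (R, m) \<notin> S)"
  by (auto simp: cell_def)

lemma swap_cells_full_empty: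
  assumes "R \<noteq> R'" "cell R \<subseteq> S" "S \<inter> cell R' = {}"
  shows "swap_cells R R' S = (S - cell R) \<union> cell R'"
  using assms unfolding cell_subset_iff disjoint_cell_iff
  by (auto simp: swap_cells_def Transposition.transpose_def split: if_splits)

lemma swap_cells_commute: "swap_cells R R' = swap_cells R' R"
  by (simp add: swap_cells_def fun_eq_iff transpose_commute)

lemma swap_cells_same:
  assumes "cell R \<subseteq> S \<and> cell R' \<subseteq> S \<or> S \<inter> cell R = {} \<and> S \<inter> cell R' = {}"
  shows "swap_cells R R' S = S"
  using assms unfolding cell_subset_iff disjoint_cell_iff
  by (auto simp: swap_cells_def Transposition.transpose_def split: if_splits)

text \<open>Both configurations arise from a common remainder \<open>X\<close>, in which both cells
  are empty, by adding one cell. Of the two quartet signs in the matrix element, one cancels against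
  \<open>phase S\<close> and the other completes the phase of the swapped configuration.\<close>

lemma hop_mult_vec:
  assumes "R \<noteq> R'"
  shows "phase S * ((qdag R ** qop R') *v x) $ S =
    (if cell R \<subseteq> S \<and> S \<inter> cell R' = {} then phase (swap_cells R R' S) * x $ (swap_cells R R' S) else 0)"
proof (cases "cell R \<subseteq> S \<and> S \<inter> cell R' = {}")
  case True
  define X where "X = S - cell R"
  have X: "X \<inter> cell R = {}" "X \<inter> cell R' = {}" and S: "S = X \<union> cell R"
    using True by (auto simp: X_def)
  have sw: "swap_cells R R' S = X \<union> cell R'"
    using True swap_cells_full_empty[OF assms] by (simp add: X_def)
  have "phase S * ((qdag R ** qop R') *v x) $ S
     = (quartet_sign R X * quartet_sign R X) * (phase X * quartet_sign R' X) * x $ (X \<union> cell R')"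
    using True X phase_add_cell[OF X(1)]
    by (simp add: qdag_mult_vec qop_mult_vec flip: matrix_vector_mul_assoc X_def S)
  then show ?thesis
    using True by (simp add: quartet_sign_sq sw phase_add_cell[OF X(2)])
next
  case False
  have "(S - cell R) \<inter> cell R' = S \<inter> cell R'" using assms by auto
  then have "((qdag R ** qop R') *v x) $ S = 0"
    using False by (simp add: qdag_mult_vec qop_mult_vec flip: matrix_vector_mul_assoc)
  then show ?thesis unfolding if_not_P[OF False] by simp
qed

lemma P4_cell: "P4 R = diag_op (\<lambda>S. of_bool (cell R \<subseteq> S))"
  by (simp add: P4_diag cell_subset_iff)

lemma P0_cell: "P0 R = diag_op (\<lambda>S. of_bool (S \<inter> cell R = {}))"
  by (simp add: P0_diag disjoint_cell_iff)

lemma full_not_empty: "cell R \<subseteq> S \<Longrightarrow> S \<inter> cell R \<noteq> {}"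
  by (auto simp: cell_def)

lemma Pcell_mult_vec: "(Pcell R *v x) $ S = of_bool (pure S R) * x $ S"
  using full_not_empty[of R S]
  by (auto simp: Pcell_def P4_cell P0_cell matrix_vector_mult_add_rdistrib diag_op_mult_vec pure_def)

lemma scaleR_matrix_vector: "(r *\<^sub>R A) *v x = r *\<^sub>R (A *v x)"
  for A :: "complex^'n^'m"
  by (simp add: vec_eq_iff matrix_vector_mult_def scaleR_sum_right)

lemma sum_matrix_vector: "(\<Sum>i\<in>I. A i) *v x = (\<Sum>i\<in>I. A i *v x)"
  for A :: "'i \<Rightarrow> complex^'n^'m"
  by (induction I rule: infinite_finite_induct) (simp_all add: matrix_vector_mult_add_rdistrib)

text \<open>A broken cell kills all four terms. If both cells are full or both empty, the terms
  vanish as well, and so does the difference, because the swap fixes \<open>S\<close>.\<close>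

lemma h_edge_mult_vec:
  assumes "R \<noteq> R'"
  shows "phase S * (h_edge R R' *v x) $ S =
    (if pure S R \<and> pure S R'
     then (phase S * x $ S - phase (swap_cells R R' S) * x $ (swap_cells R R' S)) / 2 else 0)"
proof -
  have half: "((1 / 2 :: real) *\<^sub>R v) $ S = v $ S / 2" for v :: "'a fock"
    by (simp add: complex_eq_iff)
  have "phase S * (h_edge R R' *v x) $ S =
    (of_bool (cell R \<subseteq> S \<and> S \<inter> cell R' = {}) * (phase S * x $ S)
     + of_bool (S \<inter> cell R = {} \<and> cell R' \<subseteq> S) * (phase S * x $ S)
     - phase S * ((qdag R ** qop R') *v x) $ S - phase S * ((qdag R' ** qop R) *v x) $ S) / 2"
    unfolding h_edge_def P4_cell P0_cell diag_op_mult scaleR_matrix_vector half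
      matrix_vector_mult_add_rdistrib matrix_vector_mult_diff_rdistrib
    by (simp add: diag_op_mult_vec algebra_simps of_bool_conj)
  then show ?thesis
    unfolding hop_mult_vec[OF assms] hop_mult_vec[OF assms[symmetric]] swap_cells_commute[of R' R]
      pure_def
    using full_not_empty[of R S] full_not_empty[of R' S] swap_cells_same[of R S R']
    by (cases "cell R \<subseteq> S"; cases "S \<inter> cell R = {}"; cases "cell R' \<subseteq> S"; cases "S \<inter> cell R' = {}")
      (simp_all only: simp_thms if_True if_False of_bool_eq, simp_all)
qed

section \<open>Energy levels\<close>

lemma sorted_list_of_multiset_two_least:
  fixes a b :: "'a::linorder"
  assumes "a \<le> b" "\<And>c. c \<in># N \<Longrightarrow> b \<le> c"
  shows "sorted_list_of_multiset (add_mset a (add_mset b N)) = a # b # sorted_list_of_multiset N"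
proof -
  let ?xs = "a # b # sorted_list_of_multiset N"
  have "sorted ?xs" using assms by (auto intro: order_trans)
  then have "sorted_list_of_multiset (mset ?xs) = ?xs"
    by (simp only: sorted_list_of_multiset_mset sorted_sort_id)
  then show ?thesis by simp
qed

text \<open>A simple level 0 fills only the first position of the list, and \<open>d\<close> has
  positive multiplicity, so it comes second. Since \<open>d\<close> is positive, the bound on
  nonzero levels also excludes negative ones.\<close>

lemma excitation_gap_eqI:
  fixes A :: "complex^'n^'n"
  assumes fin: "finite {e. eigenvalue_on A W (complex_of_real e)}"
    and ground: "vec.dim (eigenspace_on A W 0) = 1"
    and d: "eigenvalue_on A W (complex_of_real d)" "0 < d"
    and least: "\<And>e. eigenvalue_on A W (complex_of_real e) \<Longrightarrow> e \<noteq> 0 \<Longrightarrow> d \<le> e"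
  shows "excitation_gap A W = d"
proof -
  let ?E = "{e. eigenvalue_on A W (complex_of_real e)}"
  let ?D = "\<lambda>e :: real. vec.dim (eigenspace_on A W (complex_of_real e))"
  define M where "M = (\<Sum>e\<in>?E. replicate_mset (?D e) e)"
  have "\<not> eigenspace_on A W 0 \<subseteq> {0}" using ground vec.dim_eq_0[of "eigenspace_on A W 0"] by simp
  then have E0: "0 \<in> ?E" by (auto simp: eigenvalue_on_def)
  have "\<not> eigenspace_on A W (complex_of_real d) \<subseteq> {0}" using d(1) by (auto simp: eigenvalue_on_def)
  then have "?D d \<noteq> 0" by (simp only: vec.dim_eq_0) simp
  then obtain k where k: "?D d = Suc k" using not0_implies_Suc by blast
  define N where "N = replicate_mset k d + (\<Sum>e\<in>?E - {0} - {d}. replicate_mset (?D e) e)"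
  have "M = replicate_mset (?D 0) 0 + (replicate_mset (?D d) d + (\<Sum>e\<in>?E - {0} - {d}. replicate_mset (?D e) e))"
    unfolding M_def using fin E0 d by (subst sum.remove[of _ 0], simp, simp, subst sum.remove[of _ d]) auto
  also have "\<dots> = add_mset 0 (add_mset d N)"
    using ground k by (simp add: N_def)
  finally have M: "M = add_mset 0 (add_mset d N)" .
  have "d \<le> c" if "c \<in># N" for c
  proof -
    from that have "c = d \<or> (\<exists>e\<in>?E - {0} - {d}. c \<in># replicate_mset (?D e) e)"
      using fin by (auto simp: N_def set_mset_sum split: if_splits)
    then show ?thesis using least by (auto split: if_splits)
  qed
  then have "energy_levels A W = 0 # d # sorted_list_of_multiset N"
    using sorted_list_of_multiset_two_least[of 0 d N] d(2) unfolding energy_levels_def M_def[symmetric] M by simp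
  then show ?thesis by (simp add: excitation_gap_def)
qed

section \<open>The Hamiltonian after the change of signs\<close>

lemma swap_cells_invol [simp]: "swap_cells R R' (swap_cells R R' S) = S"
  by (simp add: swap_cells_def)

lemma swap_cells_image: "swap_cells R R' S = map_prod (Transposition.transpose R R') id ` S"
proof (intro set_eqI iffI)
  fix b assume b: "b \<in> swap_cells R R' S"
  then have "map_prod (Transposition.transpose R R') id b \<in> S" by (cases b) (simp add: swap_cells_def)
  moreover have "b = map_prod (Transposition.transpose R R') id (map_prod (Transposition.transpose R R') id b)"
    by (cases b) simp
  ultimately show "b \<in> map_prod (Transposition.transpose R R') id ` S" by blast
qed (auto simp: swap_cells_def)

lemma card_swap_cells [simp]: "card (swap_cells R R' S) = card S"
  unfolding swap_cells_image
  by (rule card_image) (auto intro!: inj_onI dest: transpose_eq_imp_eq)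

lemma pure_swap_cells: "pure S R \<Longrightarrow> pure S R' \<Longrightarrow> pure (swap_cells R R' S) P \<longleftrightarrow> pure S P"
  by (auto simp: pure_def cell_subset_iff disjoint_cell_iff swap_cells_def Transposition.transpose_def)

definition broken :: "'v mode set \<Rightarrow> 'v set" where "broken S = {R. \<not> pure S R}"

text \<open>\<open>H_exact\<close> conjugated by \<open>phase\<close>, acting on real functions. In
  \<open>J / 4\<close> one half compensates for the two orders of each edge and the other stems from
  \<open>h_edge\<close>.\<close>

definition eff_op :: "real \<Rightarrow> real \<Rightarrow> ('v::finite \<Rightarrow> 'v \<Rightarrow> bool) \<Rightarrow> ('v mode set \<Rightarrow> real) \<Rightarrow> 'v mode set \<Rightarrow> real" where
  "eff_op U J adj Y S = U * real (card (broken S)) * Y S +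
    J / 4 * (\<Sum>R\<in>UNIV. \<Sum>R'\<in>UNIV. of_bool (adj R R' \<and> pure S R \<and> pure S R') * (Y S - Y (swap_cells R R' S)))"

lemma H_exact_mult_vec:
  fixes adj :: "'v::finite \<Rightarrow> 'v \<Rightarrow> bool"
  assumes "irreflp adj"
  defines "y \<equiv> \<lambda>x S. phase S * x $ S"
  shows "phase S * (H_exact U J adj *v x) $ S
    = complex_of_real U * of_nat (card (broken S)) * y x S
      + complex_of_real (J / 4) * (\<Sum>R\<in>UNIV. \<Sum>R'\<in>UNIV. of_bool (adj R R' \<and> pure S R \<and> pure S R') * (y x S - y x (swap_cells R R' S)))"
proof -
  have sc: "(r *\<^sub>R v) $ S = complex_of_real r * v $ S" for r and v :: "'v fock"
    by (simp add: complex_eq_iff)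
  have 1: "phase S * ((\<Sum>R\<in>UNIV. mat 1 - Pcell R) *v x) $ S = of_nat (card (broken S)) * y x S"
  proof -
    have "((\<Sum>R\<in>UNIV. mat 1 - Pcell R) *v x) $ S = (\<Sum>R\<in>UNIV. x $ S - of_bool (pure S R) * x $ S)"
      by (simp add: sum_matrix_vector sum_component matrix_vector_mult_diff_rdistrib Pcell_mult_vec)
    also have "\<dots> = (\<Sum>R\<in>UNIV. of_bool (R \<in> broken S) * x $ S)"
      by (intro sum.cong refl) (auto simp: broken_def)
    also have "\<dots> = of_nat (card (broken S)) * x $ S"
      by (simp flip: sum_distrib_right)
    finally show ?thesis by (simp add: y_def mult_ac)
  qed
  have "phase S * ((\<Sum>R\<in>UNIV. \<Sum>R'\<in>{R'. adj R R'}. h_edge R R') *v x) $ S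
    = (\<Sum>R\<in>UNIV. \<Sum>R'\<in>{R'. adj R R'}. phase S * (h_edge R R' *v x) $ S)"
    by (simp add: sum_matrix_vector sum_component sum_distrib_left)
  also have "\<dots> = (\<Sum>R\<in>UNIV. \<Sum>R'\<in>UNIV. if adj R R' then phase S * (h_edge R R' *v x) $ S else 0)"
    by (simp add: sum.inter_filter[symmetric])
  also have "\<dots> = (\<Sum>R\<in>UNIV. \<Sum>R'\<in>UNIV. of_bool (adj R R' \<and> pure S R \<and> pure S R') * (y x S - y x (swap_cells R R' S)) / 2)"
  proof (intro sum.cong refl)
    fix R R'
    have "R \<noteq> R'" if "adj R R'" using that assms(1) by (auto simp: irreflp_def)
    then show "(if adj R R' then phase S * (h_edge R R' *v x) $ S else 0)
      = of_bool (adj R R' \<and> pure S R \<and> pure S R') * (y x S - y x (swap_cells R R' S)) / 2"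
      by (auto simp: h_edge_mult_vec y_def)
  qed
  finally have 2: "phase S * ((\<Sum>R\<in>UNIV. \<Sum>R'\<in>{R'. adj R R'}. h_edge R R') *v x) $ S
    = (\<Sum>R\<in>UNIV. \<Sum>R'\<in>UNIV. of_bool (adj R R' \<and> pure S R \<and> pure S R') * (y x S - y x (swap_cells R R' S))) / 2"
    by (simp only: sum_divide_distrib)
  have "phase S * (H_exact U J adj *v x) $ S
    = complex_of_real U * (phase S * ((\<Sum>R\<in>UNIV. mat 1 - Pcell R) *v x) $ S)
     + complex_of_real J * (complex_of_real (1 / 2) * (phase S * ((\<Sum>R\<in>UNIV. \<Sum>R'\<in>{R'. adj R R'}. h_edge R R') *v x) $ S))"
    unfolding H_exact_def matrix_vector_mult_add_rdistrib scaleR_matrix_vector vector_add_component sc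
    by (simp only: distrib_left mult_ac)
  then show ?thesis unfolding 1 2 by simp
qed

text \<open>The conjugated operator has real coefficients, so real and imaginary parts decouple and
  the real results on exclusion apply to each.\<close>

lemma H_exact_eigen_iff:
  fixes adj :: "'v::finite \<Rightarrow> 'v \<Rightarrow> bool"
  assumes "irreflp adj"
  shows "H_exact U J adj *v x = complex_of_real e *s x \<longleftrightarrow>
    (\<forall>S. eff_op U J adj (\<lambda>S. Re (phase S * x $ S)) S = e * Re (phase S * x $ S)) \<and>
    (\<forall>S. eff_op U J adj (\<lambda>S. Im (phase S * x $ S)) S = e * Im (phase S * x $ S))"
proof -
  have "phase S \<noteq> 0" for S :: "'v mode set" using phase_sq[of S] by auto
  then have 1: "H_exact U J adj *v x = complex_of_real e *s x \<longleftrightarrow>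
      (\<forall>S. phase S * (H_exact U J adj *v x) $ S = complex_of_real e * (phase S * x $ S))"
    by (auto simp: vec_eq_iff)
  have 2: "a = complex_of_real e * b \<longleftrightarrow> Re a = e * Re b \<and> Im a = e * Im b" for a b
    by (simp add: complex_eq_iff)
  have 3: "Re (phase S * (H_exact U J adj *v x) $ S) = eff_op U J adj (\<lambda>S. Re (phase S * x $ S)) S"
    "Im (phase S * (H_exact U J adj *v x) $ S) = eff_op U J adj (\<lambda>S. Im (phase S * x $ S)) S" for S
    unfolding H_exact_mult_vec[OF assms] eff_op_def
    by (simp_all add: of_bool_def if_distrib[of "\<lambda>t. t * _"] if_distrib[of Re] if_distrib[of Im] cong: if_cong)
  show ?thesis unfolding 1 2 3 all_conj_distrib ..
qed

lemma total_num_mult_vec: "(total_num *v x) $ S = of_nat (card S) * x $ S"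
  for x :: "'v::finite fock"
proof -
  have "(total_num *v x) $ S = (\<Sum>R\<in>UNIV. \<Sum>m\<in>UNIV. of_bool ((R, m) \<in> S) * x $ S)"
    by (simp add: total_num_def sum_matrix_vector sum_component num_op_diag diag_op_mult_vec)
  also have "\<dots> = (\<Sum>b\<in>UNIV. of_bool (b \<in> S) * x $ S)"
    unfolding sum.cartesian_product by (simp add: case_prod_unfold)
  also have "\<dots> = of_nat (card S) * x $ S" by (simp flip: sum_distrib_right)
  finally show ?thesis .
qed

lemma charge_sector_iff: "x \<in> charge_sector N \<longleftrightarrow> (\<forall>S. x $ S \<noteq> 0 \<longrightarrow> card S = N)"
  by (auto simp: charge_sector_def vec_eq_iff total_num_mult_vec)

lemma sector04_iff: "x \<in> sector04 N \<longleftrightarrow> (\<forall>S. x $ S \<noteq> 0 \<longrightarrow> card S = N \<and> broken S = {})"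
proof -
  have "(\<forall>R. Pcell R *v x = x) \<longleftrightarrow> (\<forall>S. x $ S \<noteq> 0 \<longrightarrow> broken S = {})"
    by (auto simp: vec_eq_iff Pcell_mult_vec broken_def)
  then show ?thesis by (auto simp: sector04_def charge_sector_iff)
qed

lemma dagger_H_exact: "dagger (H_exact U J adj) = H_exact U J adj"
proof -
  have P: "dagger (P0 R) = P0 R" "dagger (P4 R) = P4 R" for R :: 'a
    by (simp_all add: P0_diag P4_diag dagger_diag_op)
  have "dagger (P4 R ** P0 R') = P4 R ** P0 R'" "dagger (P0 R ** P4 R') = P0 R ** P4 R'" for R R' :: 'a
    by (simp_all add: P0_diag P4_diag diag_op_mult dagger_diag_op)
  then have "dagger (h_edge R R') = h_edge R R'" for R R' :: 'a
    by (simp add: h_edge_def dagger_add dagger_diff dagger_scaleR dagger_mult[of "qdag _"] qop_def)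
  then show ?thesis
    by (simp add: H_exact_def dagger_add dagger_diff dagger_scaleR dagger_sum dagger_mat Pcell_def P)
qed

lemma finite_H_exact_eigenvalues: "finite {e. eigenvalue_on (H_exact U J adj) W (complex_of_real e)}"
proof (rule finite_subset)
  show "finite {e. \<exists>x. x \<noteq> 0 \<and> H_exact U J adj *v x = e *\<^sub>R x}"
    by (rule finite_selfadjoint_eigenvalues) (simp add: inner_dagger dagger_H_exact)
  have "complex_of_real e *s x = e *\<^sub>R x" for e and x :: "'a fock"
    by (simp add: vec_eq_iff complex_eq_iff)
  then show "{e. eigenvalue_on (H_exact U J adj) W (complex_of_real e)}
      \<subseteq> {e. \<exists>x. x \<noteq> 0 \<and> H_exact U J adj *v x = e *\<^sub>R x}"
    by (auto simp: eigenvalue_on_def eigenspace_on_def)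
qed

lemma sum_involution_diff:
  fixes Y :: "'a \<Rightarrow> real"
  assumes s: "\<And>S. S \<in> G \<Longrightarrow> s S \<in> G \<and> s (s S) = S"
  shows "(\<Sum>S\<in>G. Y S * (Y S - Y (s S))) = (\<Sum>S\<in>G. (Y S - Y (s S))\<^sup>2) / 2"
proof -
  have "bij_betw s G G" using s by (intro bij_betw_byWitness[where f' = s]) auto
  then have "(\<Sum>S\<in>G. Y (s S) * (Y (s S) - Y (s (s S)))) = (\<Sum>S\<in>G. Y S * (Y S - Y (s S)))"
    by (rule sum.reindex_bij_betw)
  moreover have "(\<Sum>S\<in>G. Y (s S) * (Y (s S) - Y (s (s S)))) = (\<Sum>S\<in>G. Y (s S) * (Y (s S) - Y S))"
    using s by (intro sum.cong refl) auto
  moreover have "(\<Sum>S\<in>G. (Y S - Y (s S))\<^sup>2) = (\<Sum>S\<in>G. Y S * (Y S - Y (s S))) + (\<Sum>S\<in>G. Y (s S) * (Y (s S) - Y S))"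
    unfolding sum.distrib[symmetric] by (intro sum.cong refl) (simp add: power2_eq_square algebra_simps)
  ultimately show ?thesis by simp
qed

lemma card_broken:
  fixes S :: "'v::finite mode set"
  assumes "4 dvd card S" "broken S \<noteq> {}"
  shows "2 \<le> card (broken S)"
proof (rule ccontr)
  assume "\<not> 2 \<le> card (broken S)"
  moreover have "card (broken S) \<noteq> 0" using assms(2) by simp
  ultimately have "card (broken S) = 1" by linarith
  then obtain R where R: "broken S = {R}" by (auto simp: card_1_singleton_iff)
  have c4: "card (cell P) = 4" for P :: 'v by (simp add: cell_def card_cartesian_product)
  have "S = (\<Union>P\<in>UNIV. S \<inter> cell P)" by auto
  then have "card S = card (\<Union>P\<in>UNIV. S \<inter> cell P)" by simp
  also have "\<dots> = (\<Sum>P\<in>UNIV. card (S \<inter> cell P))" by (rule card_UN_disjoint) auto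
  also have "\<dots> = card (S \<inter> cell R) + (\<Sum>P\<in>UNIV - {R}. card (S \<inter> cell P))"
    by (rule sum.remove) auto
  finally have c: "card S = card (S \<inter> cell R) + (\<Sum>P\<in>UNIV - {R}. card (S \<inter> cell P))" .
  have "4 dvd (\<Sum>P\<in>UNIV - {R}. card (S \<inter> cell P))"
  proof (rule dvd_sum)
    fix P assume "P \<in> UNIV - {R}"
    then have "pure S P" using R by (auto simp: broken_def)
    then have "S \<inter> cell P = cell P \<or> S \<inter> cell P = {}" by (auto simp: pure_def)
    then show "4 dvd card (S \<inter> cell P)" by (elim disjE) (simp_all add: c4)
  qed
  then have "4 dvd card (S \<inter> cell R)" using assms(1) c by (simp add: dvd_add_left_iff)
  moreover have "card (S \<inter> cell R) \<le> 4" using card_mono[of "cell R" "S \<inter> cell R"] c4[of R] by simp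
  ultimately have "card (S \<inter> cell R) = 0 \<or> card (S \<inter> cell R) = 4" by (elim dvdE) presburger
  then have "pure S R"
  proof
    assume "card (S \<inter> cell R) = 4"
    then have "S \<inter> cell R = cell R" by (intro card_subset_eq) (auto simp: c4)
    then show ?thesis by (auto simp: pure_def)
  qed (simp add: pure_def)
  then show False using R by (auto simp: broken_def)
qed

lemma broken_swap_cells: "pure S R \<Longrightarrow> pure S R' \<Longrightarrow> broken (swap_cells R R' S) = broken S"
  by (simp add: broken_def pure_swap_cells)

lemma eff_op_low_energy_unbroken:
  fixes adj :: "'v::finite \<Rightarrow> 'v \<Rightarrow> bool"
  assumes U: "0 < U" and J: "0 < J" and e: "e < 2 * U"
    and eq: "\<And>S. eff_op U J adj Y S = e * Y S"
    and supp: "\<And>S. Y S \<noteq> 0 \<Longrightarrow> card S = 4 * M"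
    and S: "Y S \<noteq> 0"
  shows "broken S = {}"
proof (rule ccontr)
  assume br: "broken S \<noteq> {}"
  \<comment> \<open>Swaps of pure cells preserve the charge and the set of broken cells. The
    eigenvalue equation can thus be paired with \<open>Y\<close> on \<open>F\<close> alone, where
    hopping is nonnegative and the penalty is at least \<open>2 * U\<close>.\<close>
  define F where "F = {S :: 'v mode set. card S = 4 * M \<and> broken S \<noteq> {}}"
  let ?n = "\<Sum>S\<in>F. (Y S)\<^sup>2"
  have SF: "S \<in> F" using br supp[OF S] by (simp add: F_def)
  define G where "G R R' = {S \<in> F. pure S R \<and> pure S R'}" for R R'
  have hop: "(\<Sum>S\<in>F. Y S * (of_bool (adj R R' \<and> pure S R \<and> pure S R') * (Y S - Y (swap_cells R R' S)))) \<ge> 0" for R R'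
  proof -
    have "(\<Sum>S\<in>F. Y S * (of_bool (adj R R' \<and> pure S R \<and> pure S R') * (Y S - Y (swap_cells R R' S))))
       = (\<Sum>S\<in>F. if pure S R \<and> pure S R' then of_bool (adj R R') * (Y S * (Y S - Y (swap_cells R R' S))) else 0)"
      by (intro sum.cong refl) auto
    also have "\<dots> = (\<Sum>S\<in>G R R'. of_bool (adj R R') * (Y S * (Y S - Y (swap_cells R R' S))))"
      unfolding G_def by (rule sum.inter_filter[symmetric]) simp
    also have "\<dots> = of_bool (adj R R') * ((\<Sum>S\<in>G R R'. (Y S - Y (swap_cells R R' S))\<^sup>2) / 2)"
      unfolding sum_distrib_left[symmetric]
      by (subst sum_involution_diff) (auto simp: G_def F_def pure_swap_cells broken_swap_cells)
    also have "\<dots> \<ge> 0" by (intro mult_nonneg_nonneg divide_nonneg_pos sum_nonneg) auto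
    finally show ?thesis .
  qed
  have "e * ?n = (\<Sum>S\<in>F. Y S * eff_op U J adj Y S)"
    unfolding eq sum_distrib_left by (intro sum.cong refl) (simp add: power2_eq_square)
  also have "\<dots> = (\<Sum>S\<in>F. U * real (card (broken S)) * (Y S)\<^sup>2) + J / 4 *
     (\<Sum>S\<in>F. \<Sum>R\<in>UNIV. \<Sum>R'\<in>UNIV. Y S * (of_bool (adj R R' \<and> pure S R \<and> pure S R') * (Y S - Y (swap_cells R R' S))))"
    unfolding eff_op_def distrib_left sum.distrib
    by (simp only: sum_distrib_left power2_eq_square mult_ac)
  also have "(\<Sum>S\<in>F. \<Sum>R\<in>UNIV. \<Sum>R'\<in>UNIV. Y S * (of_bool (adj R R' \<and> pure S R \<and> pure S R') * (Y S - Y (swap_cells R R' S))))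
     = (\<Sum>R\<in>UNIV. \<Sum>R'\<in>UNIV. \<Sum>S\<in>F. Y S * (of_bool (adj R R' \<and> pure S R \<and> pure S R') * (Y S - Y (swap_cells R R' S))))"
    by (subst sum.swap) (intro sum.cong refl, rule sum.swap)
  finally have "e * ?n \<ge> (\<Sum>S\<in>F. U * real (card (broken S)) * (Y S)\<^sup>2)"
    using J by (simp only: add_increasing2 order_refl divide_nonneg_pos mult_nonneg_nonneg sum_nonneg hop)
  moreover have "(\<Sum>S\<in>F. U * real (card (broken S)) * (Y S)\<^sup>2) \<ge> (\<Sum>S\<in>F. U * 2 * (Y S)\<^sup>2)"
  proof (intro sum_mono mult_right_mono mult_left_mono)
    fix S assume "S \<in> F"
    then have "2 \<le> card (broken S)" by (intro card_broken) (auto simp: F_def)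
    then show "2 \<le> real (card (broken S))" by simp
  qed (use U in auto)
  ultimately have "U * 2 * ?n \<le> e * ?n" by (simp add: sum_distrib_left)
  moreover have "0 < ?n" using SF S by (intro sum_pos2[where i = S]) auto
  ultimately show False using e by simp
qed

section \<open>Unbroken configurations as an exclusion process\<close>

lemma broken_prod [simp]: "broken (A \<times> UNIV) = {}"
  by (auto simp: broken_def pure_def cell_subset_iff disjoint_cell_iff)

lemma pure_prod [simp]: "pure (A \<times> UNIV) R"
  by (auto simp: pure_def cell_subset_iff disjoint_cell_iff)

lemma full_cells_prod [simp]: "full_cells (A \<times> UNIV) = A"
  by (auto simp: full_cells_def cell_subset_iff)

lemma swap_cells_prod: "swap_cells R R' (A \<times> UNIV) = swap_set R R' A \<times> UNIV"
  by (auto simp: swap_cells_def swap_set_iff Transposition.transpose_def split: if_splits)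

lemma card_prod4 [simp]: "card (A \<times> (UNIV :: 4 set)) = 4 * card A"
  by (simp add: card_cartesian_product)

lemma unbroken_eq: "broken S = {} \<Longrightarrow> full_cells S \<times> UNIV = S"
  by (auto simp: broken_def pure_def full_cells_def cell_subset_iff disjoint_cell_iff)

definition hop_op :: "real \<Rightarrow> ('v::finite \<Rightarrow> 'v \<Rightarrow> bool) \<Rightarrow> ('v set \<Rightarrow> real) \<Rightarrow> 'v set \<Rightarrow> real" where
  "hop_op J adj f A = J / 4 * (\<Sum>R\<in>UNIV. \<Sum>R'\<in>UNIV. of_bool (adj R R') * (f A - f (swap_set R R' A)))"

lemma eff_op_prod: "eff_op U J adj Y (A \<times> UNIV) = hop_op J adj (\<lambda>A. Y (A \<times> UNIV)) A"
  by (simp add: eff_op_def hop_op_def swap_cells_prod)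

lemma hop_op_form:
  "(\<Sum>A\<in>confs UNIV k. f A * hop_op J adj f A) = J / 2 * excl_form (\<lambda>x y. of_bool (adj x y)) UNIV k f"
proof -
  have "(\<Sum>A\<in>confs UNIV k. f A * hop_op J adj f A)
    = J / 4 * (\<Sum>A\<in>confs UNIV k. \<Sum>R\<in>UNIV. \<Sum>R'\<in>UNIV. of_bool (adj R R') * (f A * (f A - f (swap_set R R' A))))"
    unfolding hop_op_def sum_distrib_left by (intro sum.cong refl) (simp only: mult_ac)
  also have "(\<Sum>A\<in>confs UNIV k. \<Sum>R\<in>UNIV. \<Sum>R'\<in>UNIV. of_bool (adj R R') * (f A * (f A - f (swap_set R R' A))))
    = (\<Sum>R\<in>UNIV. \<Sum>R'\<in>UNIV. \<Sum>A\<in>confs UNIV k. of_bool (adj R R') * (f A * (f A - f (swap_set R R' A))))"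
    by (subst sum.swap) (intro sum.cong refl, rule sum.swap)
  also have "\<dots> = (\<Sum>R\<in>UNIV. \<Sum>R'\<in>UNIV. of_bool (adj R R') * ((\<Sum>A\<in>confs UNIV k. (f A - f (swap_set R R' A))\<^sup>2) / 2))"
    unfolding sum_distrib_left[symmetric]
    by (intro sum.cong refl arg_cong2[of _ _ _ _ "(*)"] sum_involution_diff) (simp_all add: swap_set_confs)
  finally show ?thesis by (simp add: excl_form_def flip: sum_divide_distrib)
qed

lemma sum_hop_op: "(\<Sum>A\<in>confs UNIV k. hop_op J adj f A) = 0"
proof -
  have "(\<Sum>A\<in>confs UNIV k. hop_op J adj f A)
    = J / 4 * (\<Sum>A\<in>confs UNIV k. \<Sum>R\<in>UNIV. \<Sum>R'\<in>UNIV. of_bool (adj R R') * (f A - f (swap_set R R' A)))"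
    unfolding hop_op_def sum_distrib_left ..
  also have "(\<Sum>A\<in>confs UNIV k. \<Sum>R\<in>UNIV. \<Sum>R'\<in>UNIV. of_bool (adj R R') * (f A - f (swap_set R R' A)))
    = (\<Sum>R\<in>UNIV. \<Sum>R'\<in>UNIV. \<Sum>A\<in>confs UNIV k. of_bool (adj R R') * (f A - f (swap_set R R' A)))"
    by (subst sum.swap) (intro sum.cong refl, rule sum.swap)
  also have "\<dots> = 0"
    unfolding sum_distrib_left[symmetric] sum_subtractf by (simp add: sum_confs_swap)
  finally show ?thesis by simp
qed

lemma excl_form_shift: "excl_form c W k (\<lambda>A. f A - s) = excl_form c W k f"
  by (simp add: excl_form_def)

text \<open>An edge acts on a linear function through its occupied ends. The two ends contribute
  equally after renaming, which turns \<open>J / 4\<close> into \<open>J / 2\<close> and leaves the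
  Laplacian of \<open>g\<close> summed over \<open>A\<close>.\<close>

lemma hop_op_lift:
  fixes g :: "real^'v::finite"
  assumes sym: "symp adj" and g: "laplacian adj *v g = l *\<^sub>R g"
  shows "hop_op J adj (\<lambda>A. \<Sum>p\<in>A. g $ p) A = J / 2 * l * (\<Sum>p\<in>A. g $ p)"
proof -
  let ?c = "\<lambda>R R'. of_bool (adj R R') :: real"
  have c: "?c R R' = ?c R' R" for R R' using sym by (auto simp: symp_def)
  let ?X = "\<Sum>R\<in>UNIV. \<Sum>R'\<in>UNIV. ?c R R' * ((g $ R - g $ R') * of_bool (R \<in> A))"
  have "(\<Sum>R\<in>UNIV. \<Sum>R'\<in>UNIV. ?c R R' * ((g $ R - g $ R') * of_bool (R' \<in> A)))
    = (\<Sum>R'\<in>UNIV. \<Sum>R\<in>UNIV. ?c R R' * ((g $ R - g $ R') * of_bool (R' \<in> A)))"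
    by (rule sum.swap)
  also have "\<dots> = - ?X"
    unfolding sum_negf[symmetric] by (intro sum.cong refl) (simp only: c, simp add: algebra_simps)
  finally have 1: "(\<Sum>R\<in>UNIV. \<Sum>R'\<in>UNIV. ?c R R' * ((g $ R - g $ R') * of_bool (R' \<in> A))) = - ?X" .
  have "hop_op J adj (\<lambda>A. \<Sum>p\<in>A. g $ p) A = J / 4 * (\<Sum>R\<in>UNIV. \<Sum>R'\<in>UNIV.
     ?c R R' * ((g $ R - g $ R') * of_bool (R \<in> A)) - ?c R R' * ((g $ R - g $ R') * of_bool (R' \<in> A)))"
    unfolding hop_op_def by (simp only: lift_swap finite right_diff_distrib)
  also have "\<dots> = J / 2 * ?X" unfolding sum_subtractf 1 by simp
  also have "?X = (\<Sum>R\<in>UNIV. of_bool (R \<in> A) * (laplacian adj *v g) $ R)"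
    unfolding laplacian_nth sum_distrib_left by (intro sum.cong refl) (simp only: mult_ac)
  also have "\<dots> = l * (\<Sum>p\<in>A. g $ p)"
    unfolding g by (simp add: sum_distrib_left)
  finally show ?thesis by simp
qed

text \<open>Images under \<open>hop_op\<close> have sum zero, so an eigenfunction with
  \<open>e \<noteq> 0\<close> has sum zero and the gap applies to it. For \<open>e = 0\<close> the
  form vanishes, and the gap forces the deviation from the mean to be zero.\<close>

lemma exclusion_eigen:
  fixes adj :: "'v::finite \<Rightarrow> 'v \<Rightarrow> bool" and f :: "'v set \<Rightarrow> real"
  assumes sym: "symp adj" and J: "0 < J" and l: "0 < l"
    and gap: "\<And>g. (\<Sum>x\<in>UNIV. g x) = 0 \<Longrightarrow> l * (\<Sum>x\<in>UNIV. (g x)\<^sup>2) \<le> walk_form (\<lambda>x y. of_bool (adj x y)) UNIV g"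
    and eq: "\<And>A. A \<in> confs UNIV k \<Longrightarrow> hop_op J adj f A = e * f A"
  shows "e \<noteq> 0 \<Longrightarrow> A \<in> confs UNIV k \<Longrightarrow> f A \<noteq> 0 \<Longrightarrow> J / 2 * l \<le> e"
    and "e = 0 \<Longrightarrow> A \<in> confs UNIV k \<Longrightarrow> B \<in> confs UNIV k \<Longrightarrow> f A = f B"
proof -
  let ?C = "confs (UNIV :: 'v set) k" and ?E = "excl_form (\<lambda>x y. of_bool (adj x y)) UNIV k"
  have xgap: "l * (\<Sum>A\<in>?C. (h A)\<^sup>2) \<le> ?E h" if "(\<Sum>A\<in>?C. h A) = 0" for h
    using that l sym by (intro exclusion_gap gap) (auto simp: symp_def)
  have form: "e * (\<Sum>A\<in>?C. (f A)\<^sup>2) = J / 2 * ?E f"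
    unfolding hop_op_form[symmetric] sum_distrib_left
    by (intro sum.cong refl) (simp add: eq power2_eq_square)
  {
    assume "e \<noteq> 0" and A: "A \<in> ?C" "f A \<noteq> 0"
    have "e * (\<Sum>A\<in>?C. f A) = 0"
      unfolding sum_hop_op[of J adj f k, symmetric] sum_distrib_left by (intro sum.cong refl) (simp add: eq)
    then have "l * (\<Sum>A\<in>?C. (f A)\<^sup>2) \<le> ?E f" using \<open>e \<noteq> 0\<close> by (intro xgap) simp
    then have "J / 2 * (l * (\<Sum>A\<in>?C. (f A)\<^sup>2)) \<le> J / 2 * ?E f" using J by (intro mult_left_mono) auto
    then have "J / 2 * l * (\<Sum>A\<in>?C. (f A)\<^sup>2) \<le> e * (\<Sum>A\<in>?C. (f A)\<^sup>2)" using form by simp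
    moreover have "0 < (\<Sum>A\<in>?C. (f A)\<^sup>2)" using A by (intro sum_pos2[where i = A]) auto
    ultimately show "J / 2 * l \<le> e" by simp
  }
  {
    assume "e = 0" and AB: "A \<in> ?C" "B \<in> ?C"
    define s where "s = (\<Sum>A\<in>?C. f A) / real (card ?C)"
    have "card ?C \<noteq> 0" using AB by auto
    then have "(\<Sum>A\<in>?C. f A - s) = 0" by (simp add: sum_subtractf s_def)
    then have "l * (\<Sum>A\<in>?C. (f A - s)\<^sup>2) \<le> ?E (\<lambda>A. f A - s)" by (rule xgap)
    also have "\<dots> = 0" using form J \<open>e = 0\<close> by (simp add: excl_form_shift)
    finally have "(\<Sum>A\<in>?C. (f A - s)\<^sup>2) \<le> 0" using l by (simp add: mult_le_0_iff)
    then have "(\<Sum>A\<in>?C. (f A - s)\<^sup>2) = 0" by (intro order_antisym sum_nonneg) auto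
    then have "\<forall>A\<in>?C. (f A - s)\<^sup>2 = 0" by (subst (asm) sum_nonneg_eq_0_iff) auto
    then show "f A = f B" using AB by simp
  }
qed

section \<open>From exclusion eigenfunctions to eigenvectors and back\<close>

lemma eigenvalue_onI_real:
  fixes adj :: "'v::finite \<Rightarrow> 'v \<Rightarrow> bool"
  assumes "irreflp adj" and eq: "\<And>S. eff_op U J adj Y S = e * Y S"
    and W: "(\<chi> S. phase S * complex_of_real (Y S)) \<in> W" and "Y S \<noteq> 0"
  shows "eigenvalue_on (H_exact U J adj) W (complex_of_real e)"
    and "(\<chi> S. phase S * complex_of_real (Y S)) \<in> eigenspace_on (H_exact U J adj) W (complex_of_real e)"
proof -
  define x where "x = (\<chi> S. phase S * complex_of_real (Y S))"
  have y: "phase S * x $ S = complex_of_real (Y S)" for S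
    using phase_sq[of S] by (simp add: x_def flip: mult.assoc)
  have "H_exact U J adj *v x = complex_of_real e *s x"
    unfolding H_exact_eigen_iff[OF assms(1)] y using eq by (simp add: eff_op_def)
  then show "x \<in> eigenspace_on (H_exact U J adj) W (complex_of_real e)"
    using W by (simp add: eigenspace_on_def x_def)
  moreover have "x \<noteq> 0" using y[of S] assms(4) by auto
  ultimately show "eigenvalue_on (H_exact U J adj) W (complex_of_real e)"
    by (auto simp: eigenvalue_on_def)
qed

definition cell_fun :: "nat \<Rightarrow> ('v set \<Rightarrow> real) \<Rightarrow> 'v mode set \<Rightarrow> real" where
  "cell_fun M f S = (if broken S = {} \<and> card S = 4 * M then f (full_cells S) else 0)"

text \<open>Permitted swaps neither enter nor leave the unbroken sector of charge
  \<open>4 * M\<close>, so extension by zero preserves eigenfunctions.\<close>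

lemma eff_op_cell_fun:
  fixes f :: "'v::finite set \<Rightarrow> real"
  assumes eq: "\<And>A. card A = M \<Longrightarrow> hop_op J adj f A = e * f A"
  shows "eff_op U J adj (cell_fun M f) S = e * cell_fun M f S"
proof (cases "broken S = {} \<and> card S = 4 * M")
  case False
  have z: "of_bool (adj R R' \<and> pure S R \<and> pure S R') * (cell_fun M f S - cell_fun M f (swap_cells R R' S)) = 0" for R R'
    using False by (auto simp: cell_fun_def broken_swap_cells)
  have "eff_op U J adj (cell_fun M f) S = U * real (card (broken S)) * cell_fun M f S"
    by (simp only: eff_op_def z) simp
  moreover have "cell_fun M f S = 0" using False by (auto simp: cell_fun_def)
  ultimately show ?thesis by simp
next
  case True
  define A where "A = full_cells S"
  have S: "S = A \<times> UNIV" using True unbroken_eq[of S] by (simp add: A_def)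
  then have A: "card A = M" using True by simp
  have "cell_fun M f (B \<times> UNIV) = f B" if "card B = M" for B using that by (simp add: cell_fun_def)
  then show ?thesis
    using eq[OF A] A by (simp add: S eff_op_prod hop_op_def)
qed

text \<open>The alternatives in \<open>low\<close> serve the two spectra at once: energies below
  \<open>2 * U\<close> in the whole charge sector, and all energies in the unbroken sector. Either
  way the support is unbroken and \<open>Y\<close> reduces to an exclusion eigenfunction.\<close>

lemma real_eigenfunction_cases:
  fixes adj :: "'v::finite \<Rightarrow> 'v \<Rightarrow> bool"
  assumes sym: "symp adj" and conn: "connected_graph adj" and card: "2 \<le> CARD('v)" and U: "0 < U" and J: "0 < J"
    and eq: "\<And>S. eff_op U J adj Y S = e * Y S"
    and supp: "\<And>S. Y S \<noteq> 0 \<Longrightarrow> card S = 4 * M"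
    and low: "e < 2 * U \<or> (\<forall>S. Y S \<noteq> 0 \<longrightarrow> broken S = {})"
  shows "Y S \<noteq> 0 \<Longrightarrow> e \<noteq> 0 \<Longrightarrow> J / 2 * lambda2 (laplacian adj) \<le> e"
    and "e = 0 \<Longrightarrow> \<exists>a. Y = cell_fun M (\<lambda>_. a)"
proof -
  have unbroken: "broken S = {}" if "Y S \<noteq> 0" for S
    using low eff_op_low_energy_unbroken[OF U J _ eq supp that] that by blast
  define f where "f A = Y (A \<times> UNIV)" for A
  have hop: "hop_op J adj f A = e * f A" for A
    using eff_op_prod[of U J adj Y A] eq[of "A \<times> UNIV"] by (simp add: f_def[abs_def])
  have gap: "J / 2 * lambda2 (laplacian adj) \<le> e" if "e \<noteq> 0" "A \<in> confs UNIV M" "f A \<noteq> 0" for A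
    by (rule exclusion_eigen(1)[where f = f and k = M and e = e, OF sym J lambda2_laplacian(1)[OF sym conn card] _ _ that])
      (erule lambda2_laplacian(3)[OF sym conn card], rule hop)
  have const: "f A = f B" if "e = 0" "A \<in> confs UNIV M" "B \<in> confs UNIV M" for A B
    by (rule exclusion_eigen(2)[where f = f and k = M and e = e, OF sym J lambda2_laplacian(1)[OF sym conn card] _ _ that])
      (erule lambda2_laplacian(3)[OF sym conn card], rule hop)
  {
    assume S: "Y S \<noteq> 0" and e: "e \<noteq> 0"
    have SA: "S = full_cells S \<times> UNIV" using unbroken_eq[OF unbroken[OF S]] by simp
    then have "f (full_cells S) \<noteq> 0" using S by (simp add: f_def)
    moreover have "card S = 4 * card (full_cells S)" by (subst SA) (rule card_prod4)
    then have "full_cells S \<in> confs UNIV M" using supp[OF S] by (simp add: confs_def)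
    ultimately show "J / 2 * lambda2 (laplacian adj) \<le> e" using gap e by blast
  }
  {
    assume e: "e = 0"
    have "\<exists>a. \<forall>A\<in>confs UNIV M. f A = a"
      using const[OF e] by blast
    then obtain a where a: "\<And>A. A \<in> confs UNIV M \<Longrightarrow> f A = a" by blast
    have "Y S = cell_fun M (\<lambda>_. a) S" for S
    proof (cases "broken S = {} \<and> card S = 4 * M")
      case True
      have SA: "S = full_cells S \<times> UNIV" using unbroken_eq[of S] True by simp
      have "card S = 4 * card (full_cells S)" by (subst SA) (rule card_prod4)
      then have "full_cells S \<in> confs UNIV M" using True by (simp add: confs_def)
      then have "Y (full_cells S \<times> UNIV) = a" using a by (simp add: f_def)
      then show ?thesis using True by (simp add: cell_fun_def flip: SA)
    next
      case False
      then show ?thesis using unbroken[of S] supp[of S] by (auto simp: cell_fun_def)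
    qed
    then show "\<exists>a. Y = cell_fun M (\<lambda>_. a)" by blast
  }
qed

text \<open>At energy 0 the real and imaginary parts are constant on the placements of the quartets,
  with values \<open>a\<close> and \<open>b\<close>. The vector is then \<open>Complex a b\<close>
  times a fixed one, so the kernel is at most a complex line.\<close>

lemma complex_eigenvector_real_parts:
  fixes adj :: "'v::finite \<Rightarrow> 'v \<Rightarrow> bool"
  assumes irr: "irreflp adj" and sym: "symp adj" and conn: "connected_graph adj" and card: "2 \<le> CARD('v)" and U: "0 < U" and J: "0 < J"
    and x: "x \<in> eigenspace_on (H_exact U J adj) (charge_sector (4 * M)) (complex_of_real e)"
    and low: "e < 2 * U \<or> x \<in> sector04 (4 * M)"
  shows "x \<noteq> 0 \<Longrightarrow> e \<noteq> 0 \<Longrightarrow> J / 2 * lambda2 (laplacian adj) \<le> e"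
    and "e = 0 \<Longrightarrow> \<exists>k. x = k *s (\<chi> S. phase S * complex_of_real (cell_fun M (\<lambda>_. 1) S))"
proof -
  let ?Y = "\<lambda>S. Re (phase S * x $ S)" and ?Z = "\<lambda>S. Im (phase S * x $ S)"
  have "H_exact U J adj *v x = complex_of_real e *s x" "x \<in> charge_sector (4 * M)"
    using x by (auto simp: eigenspace_on_def)
  then have eqs: "\<And>S. eff_op U J adj ?Y S = e * ?Y S" "\<And>S. eff_op U J adj ?Z S = e * ?Z S"
    and supp: "\<And>S. x $ S \<noteq> 0 \<Longrightarrow> card S = 4 * M"
    unfolding H_exact_eigen_iff[OF irr] charge_sector_iff by blast+
  have nz: "x $ S \<noteq> 0" if "?Y S \<noteq> 0 \<or> ?Z S \<noteq> 0" for S using that by auto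
  have low': "e < 2 * U \<or> (\<forall>S. ?Y S \<noteq> 0 \<longrightarrow> broken S = {})" "e < 2 * U \<or> (\<forall>S. ?Z S \<noteq> 0 \<longrightarrow> broken S = {})"
    using low nz unfolding sector04_iff by blast+
  have supp': "?Y S \<noteq> 0 \<Longrightarrow> card S = 4 * M" "?Z S \<noteq> 0 \<Longrightarrow> card S = 4 * M" for S
    using supp nz by blast+
  have re1: "J / 2 * lambda2 (laplacian adj) \<le> e" if "?Y S \<noteq> 0" "e \<noteq> 0" for S
    by (rule real_eigenfunction_cases(1)[OF sym conn card U J eqs(1) _ low'(1) that]) (erule supp'(1))
  have re2: "\<exists>a. ?Y = cell_fun M (\<lambda>_. a)" if "e = 0"
    by (rule real_eigenfunction_cases(2)[OF sym conn card U J eqs(1) _ low'(1) that]) (erule supp'(1))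
  have im1: "J / 2 * lambda2 (laplacian adj) \<le> e" if "?Z S \<noteq> 0" "e \<noteq> 0" for S
    by (rule real_eigenfunction_cases(1)[OF sym conn card U J eqs(2) _ low'(2) that]) (erule supp'(2))
  have im2: "\<exists>a. ?Z = cell_fun M (\<lambda>_. a)" if "e = 0"
    by (rule real_eigenfunction_cases(2)[OF sym conn card U J eqs(2) _ low'(2) that]) (erule supp'(2))
  {
    assume "x \<noteq> 0" and e: "e \<noteq> 0"
    then obtain S where "x $ S \<noteq> 0" by (auto simp: vec_eq_iff)
    moreover have "phase S \<noteq> 0" using phase_sq[of S] by auto
    ultimately have "phase S * x $ S \<noteq> 0" by simp
    then have "?Y S \<noteq> 0 \<or> ?Z S \<noteq> 0" unfolding complex_eq_iff by simp
    then show "J / 2 * lambda2 (laplacian adj) \<le> e" using re1 im1 e by blast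
  }
  {
    assume e: "e = 0"
    obtain a b where ab: "?Y = cell_fun M (\<lambda>_. a)" "?Z = cell_fun M (\<lambda>_. b)"
      using re2[OF e] im2[OF e] by blast
    have "x $ S = Complex a b * (phase S * complex_of_real (cell_fun M (\<lambda>_. 1) S))" for S
    proof -
      have "phase S * x $ S = Complex a b * complex_of_real (cell_fun M (\<lambda>_. 1) S)"
        unfolding complex_eq_iff
        using fun_cong[OF ab(1), of S] fun_cong[OF ab(2), of S] by (simp add: cell_fun_def del: times_complex.sel)
      then have "phase S * (phase S * x $ S) = phase S * (Complex a b * complex_of_real (cell_fun M (\<lambda>_. 1) S))"
        by simp
      then show ?thesis using phase_sq[of S] by (simp add: mult_ac flip: mult.assoc)
    qed
    then show "\<exists>k. x = k *s (\<chi> S. phase S * complex_of_real (cell_fun M (\<lambda>_. 1) S))"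
      by (intro exI[of _ "Complex a b"]) (simp add: vec_eq_iff)
  }
qed

text \<open>No hop touches a broken cell, so two of them stay frozen and cost \<open>2 * U\<close>.
  Spreading the amplitude evenly over all placements of the remaining quartets makes every hopping
  difference vanish.\<close>

lemma broken_pair_eigenvalue:
  fixes adj :: "'v::finite \<Rightarrow> 'v \<Rightarrow> bool"
  assumes irr: "irreflp adj" and M: "1 \<le> M" "M \<le> CARD('v) - 1"
  shows "eigenvalue_on (H_exact U J adj) (charge_sector (4 * M)) (complex_of_real (2 * U))"
proof -
  have "2 \<le> CARD('v)" using M by linarith
  then obtain a b :: 'v where ab: "a \<noteq> b"
    using card_le_Suc0_iff_eq[of "UNIV :: 'v set"] by auto
  \<comment> \<open>One fermion in \<open>a\<close> and three in \<open>b\<close> carry charge 4,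
    which leaves exactly \<open>M - 1\<close> quartets to place.\<close>
  define B :: "'v mode set" where "B = {(a, 1), (b, 2), (b, 3), (b, 4)}"
  define Q where "Q S \<longleftrightarrow> card S = 4 * M \<and> S \<inter> (cell a \<union> cell b) = B \<and> broken S = {a, b}" for S
  define Y :: "'v mode set \<Rightarrow> real" where "Y S = of_bool (Q S)" for S
  have swap: "Q (swap_cells R R' S) \<longleftrightarrow> Q S" if "pure S R" "pure S R'" for R R' S
  proof -
    have "S \<inter> (cell a \<union> cell b) = swap_cells R R' S \<inter> (cell a \<union> cell b)" if "broken S = {a, b}"
    proof -
      have "R \<noteq> a" "R \<noteq> b" "R' \<noteq> a" "R' \<noteq> b" using that \<open>pure S R\<close> \<open>pure S R'\<close> by (auto simp: broken_def)
      then show ?thesis by (auto simp: swap_cells_def Transposition.transpose_def)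
    qed
    then show ?thesis using that by (auto simp: Q_def broken_swap_cells)
  qed
  have eq: "eff_op U J adj Y S = 2 * U * Y S" for S
  proof -
    have z: "of_bool (adj R R' \<and> pure S R \<and> pure S R') * (Y S - Y (swap_cells R R' S)) = 0" for R R'
      by (auto simp: Y_def swap)
    have "eff_op U J adj Y S = U * real (card (broken S)) * Y S" by (simp only: eff_op_def z) simp
    also have "\<dots> = 2 * U * Y S" using ab by (simp add: Y_def Q_def)
    finally show ?thesis .
  qed
  \<comment> \<open>The upper bound on \<open>M\<close> enters here: the quartets must fit into the
    \<open>CARD('v) - 2\<close> cells other than \<open>a\<close> and \<open>b\<close>.\<close>
  have "M - 1 \<le> card (UNIV - {a, b} :: 'v set)" using M ab by (simp add: card_Diff_subset)
  then obtain D where D: "D \<subseteq> UNIV - {a, b}" "card D = M - 1" by (meson obtain_subset_with_card_n)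
  define S where "S = B \<union> D \<times> UNIV"
  have "card B = 4" using ab distinct_four by (simp add: B_def)
  moreover have "card S = card B + card (D \<times> (UNIV :: 4 set))"
    unfolding S_def using D by (intro card_Un_disjoint) (auto simp: B_def)
  ultimately have "card S = 4 * M" using D M by simp
  moreover have "S \<inter> (cell a \<union> cell b) = B" using D by (auto simp: S_def B_def)
  moreover have "broken S = {a, b}"
  proof -
    have "(R, m) \<in> S \<longleftrightarrow> (R, m) \<in> B \<or> R \<in> D" for R m by (auto simp: S_def)
    moreover have "(a, 1) \<in> B" "(a, 2) \<notin> B" "(b, 1) \<notin> B" "(b, 2) \<in> B" "\<And>R m. R \<noteq> a \<Longrightarrow> R \<noteq> b \<Longrightarrow> (R, m) \<notin> B"
      using ab distinct_four by (auto simp: B_def)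
    moreover have "a \<notin> D" "b \<notin> D" using D by auto
    ultimately have "pure S R \<longleftrightarrow> R \<noteq> a \<and> R \<noteq> b" for R
      unfolding pure_def cell_subset_iff disjoint_cell_iff by metis
    then show ?thesis by (auto simp: broken_def)
  qed
  ultimately have "Y S \<noteq> 0" by (simp add: Y_def Q_def)
  moreover have "(\<chi> S. phase S * complex_of_real (Y S)) \<in> charge_sector (4 * M)"
    by (auto simp: charge_sector_iff Y_def Q_def)
  ultimately show ?thesis using eigenvalue_onI_real(1)[OF irr eq] by blast
qed

theorem theorem2:
  fixes adj :: "'v::finite \<Rightarrow> 'v \<Rightarrow> bool" and U J :: real and M :: nat
  assumes "simple_graph adj" and "connected_graph adj"
    and "U > 0" and "J > 0"
    and "1 \<le> M" and "M \<le> CARD('v) - 1"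
  shows "excitation_gap (H_exact U J adj) (sector04 (4 * M)) = J / 2 * lambda2 (laplacian adj) \<and>
    excitation_gap (H_exact U J adj) (charge_sector (4 * M)) =
      min (J / 2 * lambda2 (laplacian adj)) (2 * U)"
proof -
  note conn = assms(2) and U = assms(3) and J = assms(4) and M = assms(5,6)
  have sym: "symp adj" and irr: "irreflp adj" using assms(1) by (auto simp: simple_graph_def)
  have card: "2 \<le> CARD('v)" using M by linarith
  let ?H = "H_exact U J adj" and ?d = "J / 2 * lambda2 (laplacian adj)"
  let ?W = "charge_sector (4 * M) :: 'v fock set" and ?V = "sector04 (4 * M) :: 'v fock set"
  note real_parts = complex_eigenvector_real_parts[OF irr sym conn card U J]
  have VW: "?V \<subseteq> ?W" by (auto simp: sector04_def)
  have esub: "eigenspace_on ?H ?V e \<subseteq> eigenspace_on ?H ?W e" for e using VW by (auto simp: eigenspace_on_def)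
  have emb: "(\<chi> S. phase S * complex_of_real (cell_fun M f S)) \<in> ?V" for f
    by (auto simp: sector04_iff cell_fun_def)
  have d0: "0 < ?d" using J lambda2_laplacian(1)[OF sym conn card] by simp
  obtain g :: "real^'v" where g: "g \<noteq> 0" "laplacian adj *v g = lambda2 (laplacian adj) *\<^sub>R g" "(\<Sum>x\<in>UNIV. g $ x) = 0"
    using lambda2_laplacian(2)[OF sym conn card] by blast
  have dV: "eigenvalue_on ?H ?V (complex_of_real ?d)"
  proof -
    define f where "f A = (\<Sum>p\<in>A. g $ p)" for A
    have eq: "eff_op U J adj (cell_fun M f) S = ?d * cell_fun M f S" for S
      by (rule eff_op_cell_fun) (simp only: f_def[abs_def] hop_op_lift[OF sym g(2)])
    obtain p where p: "g $ p \<noteq> 0" using g(1) by (auto simp: vec_eq_iff)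
    \<comment> \<open>The lift of \<open>g\<close> is nonzero because its marginal at
      \<open>p\<close> is a positive multiple of \<open>g $ p\<close>; the binomial coefficient is
      positive as \<open>M - 1 \<le> CARD('v) - 2\<close>.\<close>
    have "(\<Sum>A\<in>{A \<in> confs UNIV M. p \<in> A}. f A) = real ((CARD('v) - 2) choose (M - 1)) * g $ p"
      unfolding f_def by (rule marginal_lift) (use g M in auto)
    also have "\<dots> \<noteq> 0" using p M by simp
    finally obtain A where A: "A \<in> confs UNIV M" "f A \<noteq> 0"
      by (metis (mono_tags, lifting) mem_Collect_eq sum.neutral)
    then have "cell_fun M f (A \<times> UNIV) \<noteq> 0" by (simp add: cell_fun_def confs_def)
    then show ?thesis by (rule eigenvalue_onI_real(1)[OF irr eq emb])
  qed
  then have dW: "eigenvalue_on ?H ?W (complex_of_real ?d)" using esub by (auto simp: eigenvalue_on_def)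
  \<comment> \<open>The even superposition, up to phases, of all placements of \<open>M\<close>
    quartets; every swap fixes it, so its energy is 0.\<close>
  define x0 :: "'v fock" where "x0 = (\<chi> S. phase S * complex_of_real (cell_fun M (\<lambda>_. 1) S))"
  have "M \<le> CARD('v)" using M by linarith
  then obtain A :: "'v set" where A: "card A = M" by (meson obtain_subset_with_card_n)
  have "cell_fun M (\<lambda>_. 1) (A \<times> UNIV) \<noteq> 0" using A by (simp add: cell_fun_def)
  moreover have "eff_op U J adj (cell_fun M (\<lambda>_. 1)) S = 0 * cell_fun M (\<lambda>_. 1) S" for S
    by (rule eff_op_cell_fun) (simp add: hop_op_def)
  ultimately have x0: "x0 \<in> eigenspace_on ?H ?V 0"
    using eigenvalue_onI_real(2)[OF irr _ emb, of U J "\<lambda>_. 1" 0] unfolding x0_def by simp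
  have "x0 $ (A \<times> UNIV) \<noteq> 0"
    using A phase_sq[of "A \<times> (UNIV :: 4 set)"] by (auto simp: x0_def cell_fun_def)
  then have x0_nz: "x0 \<noteq> 0" by auto
  \<comment> \<open>Leaving \<open>X\<close> open covers both sectors with one argument.\<close>
  have ground: "vec.dim (eigenspace_on ?H X 0) = 1" if "x0 \<in> eigenspace_on ?H X 0" "X \<subseteq> ?W" for X
  proof (rule vec.dim_unique[of "{x0}"])
    show "eigenspace_on ?H X 0 \<subseteq> vec.span {x0}"
    proof
      fix x assume "x \<in> eigenspace_on ?H X 0"
      then have "x \<in> eigenspace_on ?H ?W (complex_of_real 0)" using that(2) by (auto simp: eigenspace_on_def)
      then obtain k where "x = k *s x0" using real_parts(2)[of x M 0] U unfolding x0_def by auto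
      then show "x \<in> vec.span {x0}" by (simp add: vec.span_scale vec.span_base)
    qed
  qed (use that x0_nz in auto)
  have "excitation_gap ?H ?V = ?d"
  proof (rule excitation_gap_eqI[OF finite_H_exact_eigenvalues ground[OF x0 VW] dV d0])
    fix e assume "eigenvalue_on ?H ?V (complex_of_real e)" and e: "e \<noteq> 0"
    then obtain x where x: "x \<in> eigenspace_on ?H ?V (complex_of_real e)" "x \<noteq> 0" by (auto simp: eigenvalue_on_def)
    moreover have "x \<in> ?V" using x by (simp add: eigenspace_on_def)
    ultimately show "?d \<le> e" using real_parts(1)[of x M e] esub e by blast
  qed
  moreover have "excitation_gap ?H ?W = min ?d (2 * U)"
  proof (rule excitation_gap_eqI[OF finite_H_exact_eigenvalues ground])
    show "x0 \<in> eigenspace_on ?H ?W 0" using x0 esub by blast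
    show "eigenvalue_on ?H ?W (complex_of_real (min ?d (2 * U)))"
      using dW broken_pair_eigenvalue[OF irr M, of U J] by (simp add: min_def)
    show "0 < min ?d (2 * U)" using d0 U by simp
    fix e assume "eigenvalue_on ?H ?W (complex_of_real e)" and e: "e \<noteq> 0"
    then obtain x where x: "x \<in> eigenspace_on ?H ?W (complex_of_real e)" "x \<noteq> 0" by (auto simp: eigenvalue_on_def)
    \<comment> \<open>Below \<open>2 * U\<close> the vector is unbroken and the exclusion gap
      applies; otherwise \<open>2 * U\<close> already bounds the minimum.\<close>
    show "min ?d (2 * U) \<le> e"
      using real_parts(1)[OF x(1) _ x(2) e] by (cases "e < 2 * U") auto
  qed simp
  ultimately show ?thesis by blast
qed

end
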